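(* For every $\varepsilon \geq 0$ there exists a constant $C_\varepsilon>0$, depending only on $\varepsilon$ and not on $q$, such that, for every integer $q\geq 2$ and all $t \geq 1$, \begin{align*} &\sup_{y \in \mathbb{T}_{q+1}} \sum_{x \in \mathbb{T}_{q+1}} |H_t(x,y)| \, e^{\varepsilon d(x,y)/\sqrt{t}}\,\mu(x) \le C_\varepsilon, \\ &\sup_{y \in \mathbb{T}_{q+1}} \sum_{x \in \mathbb{T}_{q+1}} |\nabla_x H_t(x,y)| \, e^{\varepsilon d(x,y)/\sqrt{t}}\, \mu(x) \le \frac{C_\varepsilon}{\sqrt{t}}, \\ &\sup_{y \in \mathbb{T}_{q+1}} \sum_{x \in \mathbb{T}_{q+1}} |\nabla_y H_t(x,y)| \, e^{\varepsilon d(x,y)/\sqrt{t}}\, \mu(x) \le \frac{C_\varepsilon}{\sqrt{t}}, \\ &\sup_{y \in \mathbb{T}_{q+1}} \sum_{x \in \mathbb{T}_{q+1}} |\nabla_y \nabla_x H_t(x,y)| \, e^{\varepsilon d(x,y)/\sqrt{t}}\, \mu(x) \le \frac{C_\varepsilon}{t}. \end{align*}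
   Context: Let $q\geq 2$ be an integer and let $\mathbb{T}_{q+1}$ be the homogeneous tree of degree $q+1$ (the connected graph without cycles in which each vertex has exactly $q+1$ neighbours), identified with its vertex set, with graph distance $d$; $x\sim y$ means that $x,y$ are neighbours. Fix a reference vertex $o$ and a ray $\omega_*$ (half-infinite geodesic emanating from $o$). The level of a vertex $x$ is the integer $\ell(x)=d(o,x\wedge\omega_* )-d(x,x\wedge\omega_* )$, where $x\wedge\omega_*$ is the closest point to $x$ on $\omega_*$. Every vertex $x$ has exactly one neighbour of level $\ell(x)+1$, its predecessor $\mathfrak{p}(x)$; its other $q$ neighbours have level $\ell(x)-1$. The canonical flow measure is $\mu(x)=q^{\ell(x)}$. The flow gradient of $f:\mathbb{T}_{q+1}\to\mathbb{C}$ is $\nabla f(x)=f(x)-f(\mathfrak{p}(x))$. For a function of two variables, $\nabla_x$ and $\nabla_y$ denote the flow gradient in the indicated variable, e.g. $\nabla_xH(x,y)=H(x,y)-H(\mathfrak{p}(x),y)$. The flow Laplacian is $$\mathcal{L} f(x)=\tfrac12\nabla^*\nabla f(x) = f(x)-\frac{1}{2\sqrt q}\sum_{y\sim x}\frac{\mu^{1/2}(y)}{\mu^{1/2}(x)}f(y),$$ where $\nabla^*$ is the adjoint of $\nabla$ on $L^2(\mu)$; it is bounded, self-adjoint and nonnegative on $L^2(\mu)$. For $t>0$, $H_t$ denotes the integral kernel of $e^{-t\mathcal{L}}$ with respect to $\mu$: $e^{-t\mathcal{L}}f(x)=\sum_{y\in\mathbb{T}_{q+1}}H_t(x,y)f(y)\mu(y)$.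 *)

theory Defs
  imports "HOL-Analysis.Analysis"
begin

text \<open>The vertices of the tree are all the elements of the type \<open>'a\<close>.\<close>

locale homogeneous_tree =
  fixes q :: nat
    and adj :: "'a \<Rightarrow> 'a \<Rightarrow> bool"
  assumes q_ge_2: "q \<ge> 2"
    and adj_sym: "adj x y \<Longrightarrow> adj y x"
    and adj_irrefl: "\<not> adj x x"
    and connected: "adj\<^sup>*\<^sup>* x y"
    and no_cycles: "\<lbrakk>length xs \<ge> 3; distinct xs; successively adj xs\<rbrakk> \<Longrightarrow> \<not> adj (last xs) (hd xs)"
    and degree: "card {y. adj x y} = q + 1"
begin

definition gdist :: "'a \<Rightarrow> 'a \<Rightarrow> nat" where
  "gdist x y = (LEAST n. (adj ^^ n) x y)"

end

text \<open>The ray is the sequence \<open>\<omega>\<close> of its vertices; the reference vertex \<open>o\<close> is \<open>\<omega> 0\<close>.\<close>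

locale flow_tree = homogeneous_tree q adj
  for q :: nat and adj :: "'a \<Rightarrow> 'a \<Rightarrow> bool" +
  fixes \<omega> :: "nat \<Rightarrow> 'a"
  assumes geodesic_ray: "m \<le> n \<Longrightarrow> gdist (\<omega> m) (\<omega> n) = n - m"
begin

definition ray_proj :: "'a \<Rightarrow> 'a" where
  "ray_proj x = (ARG_MIN (gdist x) z. z \<in> range \<omega>)"

definition level :: "'a \<Rightarrow> int" where
  "level x = int (gdist (\<omega> 0) (ray_proj x)) - int (gdist x (ray_proj x))"

definition predecessor :: "'a \<Rightarrow> 'a" where
  "predecessor x = (THE y. adj x y \<and> level y = level x + 1)"

definition flow_measure :: "'a \<Rightarrow> real" where
  "flow_measure x = real q powi level x"

definition flow_grad :: "('a \<Rightarrow> complex) \<Rightarrow> 'a \<Rightarrow> complex" where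
  "flow_grad f x = f x - f (predecessor x)"

definition grad_x :: "('a \<Rightarrow> 'a \<Rightarrow> complex) \<Rightarrow> 'a \<Rightarrow> 'a \<Rightarrow> complex" where
  "grad_x H x y = flow_grad (\<lambda>x'. H x' y) x"

definition grad_y :: "('a \<Rightarrow> 'a \<Rightarrow> complex) \<Rightarrow> 'a \<Rightarrow> 'a \<Rightarrow> complex" where
  "grad_y H x y = flow_grad (\<lambda>y'. H x y') y"

text \<open>
  This is one half of the composition of the adjoint of \<open>flow_grad\<close> on \<open>L2(flow_measure)\<close> with
  \<open>flow_grad\<close>, written out.
\<close>

definition flow_laplacian :: "('a \<Rightarrow> complex) \<Rightarrow> 'a \<Rightarrow> complex" where
  "flow_laplacian f x = f x - of_real (1 / (2 * sqrt (real q))) *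
     (\<Sum>y | adj x y. of_real (sqrt (flow_measure y) / sqrt (flow_measure x)) * f y)"

definition L2_flow :: "('a \<Rightarrow> complex) set" where
  "L2_flow = {f. (\<lambda>x. (cmod (f x))\<^sup>2 * flow_measure x) summable_on UNIV}"

definition L2_flow_norm :: "('a \<Rightarrow> complex) \<Rightarrow> real" where
  "L2_flow_norm f = sqrt (\<Sum>\<^sub>\<infinity>x. (cmod (f x))\<^sup>2 * flow_measure x)"

text \<open>
  The operator \<open>exp (- t L)\<close> is the exponential of a bounded operator on the Hilbert space
  \<open>L2_flow\<close>: its value at \<open>f\<close> is the sum, in the norm of that space, of the series with terms
  \<open>(- t) ^ n / n! (L ^^ n) f\<close>. It is meaningful only for \<open>f \<in> L2_flow\<close>.
\<close>

definition heat_semigroup :: "real \<Rightarrow> ('a \<Rightarrow> complex) \<Rightarrow> 'a \<Rightarrow> complex" where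
  "heat_semigroup t f = (THE g. g \<in> L2_flow \<and>
     (\<lambda>N. L2_flow_norm (\<lambda>x. (\<Sum>n<N. of_real ((- t) ^ n / fact n) * (flow_laplacian ^^ n) f x) - g x))
       \<longlonglongrightarrow> 0)"

definition heat_kernel :: "real \<Rightarrow> 'a \<Rightarrow> 'a \<Rightarrow> complex" where
  "heat_kernel t = (THE H. \<forall>f\<in>L2_flow. \<forall>x.
     ((\<lambda>y. H x y * f y * of_real (flow_measure y)) has_sum heat_semigroup t f x) UNIV)"

end

end

theory Submission imports Defs begin

text \<open>
  Since the square root of \<open>\<mu>(y)/\<mu>(x)\<close> is \<open>\<surd>q\<close> for the predecessor of \<open>x\<close> and \<open>1/\<surd>q\<close> for its
  other neighbours, \<open>P = I - L\<close> is a Markov operator: with probability 1/2 go to the predecessor,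
  otherwise to a uniformly chosen child. If \<open>U\<close> denotes the step up and \<open>D\<close> the averaged step down,
  then \<open>D\<close> is the adjoint of \<open>U\<close>, \<open>D U = I\<close>, and every power of \<open>(I + P)/2\<close> is a combination of
  the operators \<open>U^a D^b\<close>. By the reflection principle the coefficient of \<open>U^a D^b\<close> in the \<open>n\<close>-th
  power is a ballot number \<open>c(a + b)\<close>, with \<open>c(m) = p(m) - p(m + 2)\<close> for the law \<open>p\<close> of the lazy
  walk on the integers at time \<open>n\<close>; it does not depend on \<open>q\<close>. As \<open>U^a D^b\<close> is doubly stochastic and
  only connects points at distance at most \<open>a + b\<close>, each of the four sums is at most the weighted
  \<open>l^1\<close> norm of the coefficients of the kernel, and a gradient acts on these as a difference operator
  in \<open>a\<close> or in \<open>b\<close>. So only differences of ballot numbers have to be estimated, and these are explicit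
  rational multiples of binomial coefficients. Finally
  \<open>exp (- t L) = exp (- 2 t) exp (2 t (I + P)/2)\<close> is a Poisson mixture of the powers of \<open>(I + P)/2\<close>.
\<close>

section \<open>Geometry of the tree\<close>

context homogeneous_tree begin

lemma relpowp_adj_sym: "(adj ^^ n) x y \<Longrightarrow> (adj ^^ n) y x"
proof (induction n arbitrary: x y)
  case (Suc n)
  then obtain z where "(adj ^^ n) x z" "adj z y" by auto
  then show ?case using Suc.IH adj_sym relpowp_Suc_I2 by metis
qed auto

lemma gdist_relpowp: "(adj ^^ gdist x y) x y"
  unfolding gdist_def by (rule LeastI_ex) (use connected rtranclp_imp_relpowp in metis)

lemma gdist_le: "(adj ^^ n) x y \<Longrightarrow> gdist x y \<le> n"
  unfolding gdist_def by (rule Least_le)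

lemma gdist_sym: "gdist x y = gdist y x"
  by (meson gdist_le gdist_relpowp relpowp_adj_sym antisym)

lemma gdist_self [simp]: "gdist x x = 0"
  using gdist_le[of 0 x x] by simp

lemma gdist_eq_0 [simp]: "gdist x y = 0 \<longleftrightarrow> x = y"
  using gdist_relpowp[of x y] by auto

lemma gdist_triangle: "gdist x z \<le> gdist x y + gdist y z"
  by (intro gdist_le) (meson gdist_relpowp relpowp_trans)

lemma gdist_adj_le: "adj x y \<Longrightarrow> gdist x y \<le> 1"
  by (rule gdist_le) auto

lemma adj_if_gdist_eq_1: "gdist x y = 1 \<Longrightarrow> adj x y"
  using gdist_relpowp[of x y] by auto

text \<open>The last but one vertex of a shortest path from \<open>w\<close> to \<open>x\<close>
  qualifies.\<close>

lemma closer_neighbour: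
  assumes "gdist w x = Suc n"
  obtains u where "adj x u" "gdist w u = n"
proof -
  obtain u where u: "(adj ^^ n) w u" "adj u x"
    using gdist_relpowp[of w x] assms by auto
  have "gdist w x \<le> gdist w u + gdist u x" by (rule gdist_triangle)
  then have "gdist w u = n"
    using gdist_le[OF u(1)] gdist_adj_le[OF u(2)] assms by linarith
  then show thesis using that u adj_sym by blast
qed

text \<open>Prolonging both ends of such a path towards \<open>w\<close> eventually closes a cycle.\<close>

lemma no_path_outside_ball:
  assumes "successively adj zs" "distinct zs" "length zs \<ge> 2"
    "gdist w (hd zs) = n" "gdist w (last zs) = n" "\<And>z. z \<in> set zs \<Longrightarrow> gdist w z \<ge> n"
  shows False
  using assms
proof (induction n arbitrary: zs)
  case 0
  \<comment> \<open>At radius 0 both ends equal \<open>w\<close>, impossible in a distinct list of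
    length at least 2.\<close>
  then obtain a b zs' where "zs = a # b # zs'"
    by (metis Suc_le_length_iff numeral_2_eq_2)
  with 0 show ?case by (auto split: if_splits)
next
  case (Suc n)
  obtain u where u: "adj (hd zs) u" "gdist w u = n" using closer_neighbour Suc.prems by metis
  obtain u' where u': "adj (last zs) u'" "gdist w u' = n" using closer_neighbour Suc.prems by metis
  have ne: "zs \<noteq> []" using Suc.prems(3) by auto
  have notin: "u \<notin> set zs" "u' \<notin> set zs" using Suc.prems(6) u(2) u'(2) by force+
  show ?case
  proof (cases "u = u'")
    case True
    \<comment> \<open>Both prolongations meet in \<open>u\<close>, so \<open>u # zs\<close> closes
      up to a cycle.\<close>
    have "successively adj (u # zs)"
      using Suc.prems(1) adj_sym[OF u(1)] ne by (cases zs) auto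
    moreover have "distinct (u # zs)" using notin Suc.prems(2) by auto
    ultimately show ?thesis
      using no_cycles[of "u # zs"] Suc.prems(3) u'(1) True ne by simp
  next
    case False
    have "successively adj (u # zs)"
      using Suc.prems(1) adj_sym[OF u(1)] ne by (cases zs) auto
    then have s: "successively adj ((u # zs) @ [u'])"
      using u'(1) ne by (subst successively_append_iff) auto
    \<comment> \<open>The path prolonged by one vertex at both ends satisfies the hypotheses at
      radius \<open>n\<close>.\<close>
    show ?thesis
    proof (rule Suc.IH[OF s])
      show "distinct ((u # zs) @ [u'])" using notin Suc.prems(2) False by auto
      show "n \<le> gdist w z" if "z \<in> set ((u # zs) @ [u'])" for z
        using that u u' Suc.prems(6)[of z] by auto
    qed (use Suc.prems(3) u u' in auto)
  qed
qed

text \<open>Trees are bipartite: adjacent vertices at equal distance from \<open>w\<close> would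
  form a path that \<open>no_path_outside_ball\<close> excludes.\<close>

lemma gdist_adj_cases:
  assumes "adj x y"
  obtains "gdist w y = Suc (gdist w x)" | "gdist w x = Suc (gdist w y)"
proof -
  have "gdist w x \<le> gdist w y + 1" "gdist w y \<le> gdist w x + 1"
    using gdist_triangle[of w x y] gdist_triangle[of w y x] gdist_adj_le[OF assms]
      gdist_adj_le[OF adj_sym[OF assms]] by linarith+
  moreover have "gdist w x \<noteq> gdist w y"
  proof
    assume eq: "gdist w x = gdist w y"
    have "x \<noteq> y" using assms adj_irrefl by auto
    then show False
      by (intro no_path_outside_ball[of "[x, y]" w "gdist w x"]) (use assms eq in auto)
  qed
  ultimately show thesis using that by linarith
qed

text \<open>Two such neighbours would give the forbidden path \<open>[y, x, y']\<close>, with its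
  ends on a sphere around \<open>w\<close> and its middle outside.\<close>

lemma closer_neighbour_unique:
  assumes "adj x y" "adj x y'" "gdist w x = Suc (gdist w y)" "gdist w x = Suc (gdist w y')"
  shows "y = y'"
proof (rule ccontr)
  assume "y \<noteq> y'"
  show False
    by (rule no_path_outside_ball[of "[y, x, y']" w "gdist w y"])
      (use assms(2-) adj_sym[OF assms(1)] \<open>y \<noteq> y'\<close> in auto)
qed

lemma finite_neighbours [simp]: "finite {y. adj x y}"
  using degree[of x] card.infinite by fastforce

end

section \<open>Levels, predecessors and children\<close>

context flow_tree begin

lemma adj_ray: "adj (\<omega> n) (\<omega> (Suc n))"
  using geodesic_ray[of n "Suc n"] adj_if_gdist_eq_1 by auto

text \<open>A ray moving away from \<open>x\<close> never turns back: otherwise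
  \<open>\<omega> n\<close> and \<open>\<omega> (n + 2)\<close> would both be the neighbour of
  \<open>\<omega> (n + 1)\<close> closer to \<open>x\<close>, hence equal.\<close>

lemma gdist_ray_step:
  assumes "gdist x (\<omega> (Suc n)) = Suc (gdist x (\<omega> n))"
  shows "gdist x (\<omega> (Suc (Suc n))) = Suc (gdist x (\<omega> (Suc n)))"
proof (cases rule: gdist_adj_cases[OF adj_ray[of "Suc n"], of x])
  case 2
  have "\<omega> n = \<omega> (Suc (Suc n))"
    using closer_neighbour_unique[of "\<omega> (Suc n)" "\<omega> n" "\<omega> (Suc (Suc n))" x]
      assms 2 adj_ray adj_sym[OF adj_ray[of n]] by auto
  then show ?thesis using geodesic_ray[of n "Suc (Suc n)"] by auto
qed auto

text \<open>The level is a Busemann function. Beyond the closest point the distance from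
  \<open>x\<close> grows by one per step along the ray, so that point may be replaced by any later
  one, and levels become distances to a single far point.\<close>

lemma level_eventually: "\<exists>n0. \<forall>n\<ge>n0. level x = int n - int (gdist x (\<omega> n))"
proof -
  obtain i where i: "ray_proj x = \<omega> i" and min: "\<And>n. gdist x (\<omega> i) \<le> gdist x (\<omega> n)"
  proof -
    have "is_arg_min (gdist x) (\<lambda>z. z \<in> range \<omega>) (ray_proj x)"
      unfolding ray_proj_def by (rule is_arg_min_arg_min_nat[of _ "\<omega> 0"]) auto
    then show thesis using that by (auto simp: is_arg_min_linorder)
  qed
  have up: "gdist x (\<omega> (Suc (i + k))) = Suc (gdist x (\<omega> (i + k)))" for k
  proof (induction k)
    case 0
    show ?case
      using min[of "Suc i"] by (cases rule: gdist_adj_cases[OF adj_ray[of i], of x]) auto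
  next
    case (Suc k)
    then show ?case using gdist_ray_step by simp
  qed
  have "gdist x (\<omega> (i + k)) = gdist x (\<omega> i) + k" for k
    by (induction k) (use up in auto)
  moreover have "gdist (\<omega> 0) (\<omega> i) = i" using geodesic_ray[of 0 i] by simp
  ultimately have "level x = int n - int (gdist x (\<omega> n))" if "n \<ge> i" for n
    using that le_Suc_ex[OF that] unfolding level_def i by auto
  then show ?thesis by blast
qed

text \<open>Seen from a far point \<open>w\<close> of the ray, the level of \<open>x\<close> and of
  its neighbours is a constant minus the distance to \<open>w\<close>; the upper neighbour is the
  unique one closer to \<open>w\<close>.\<close>

lemma level_neighbours:
  shows "\<exists>!y. adj x y \<and> level y = level x + 1"
    and "adj x y \<Longrightarrow> level y = level x + 1 \<or> level y = level x - 1"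
proof -
  have "\<forall>z. \<exists>n0. \<forall>n\<ge>n0. level z = int n - int (gdist z (\<omega> n))"
    using level_eventually by blast
  then obtain n0 where n0: "\<And>z n. n \<ge> n0 z \<Longrightarrow> level z = int n - int (gdist z (\<omega> n))" by metis
  \<comment> \<open>The maximum makes the formula of \<open>level_eventually\<close> valid at
    \<open>x\<close> and at all its neighbours; the remaining summands keep \<open>w\<close> away
    from \<open>x\<close>, so that a closer neighbour exists.\<close>
  define n where "n = Max (n0 ` insert x {y. adj x y}) + gdist x (\<omega> 0) + 1"
  define w where "w = \<omega> n"
  have "n0 z \<le> n" if "z \<in> insert x {y. adj x y}" for z
  proof -
    have "n0 z \<le> Max (n0 ` insert x {y. adj x y})" using that by (intro Max_ge finite_imageI imageI) simp_all
    then show ?thesis unfolding n_def by linarith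
  qed
  then have lev: "level z = int n - int (gdist w z)" if "z = x \<or> adj x z" for z
    using n0[of z n] that gdist_sym[of z w] unfolding w_def by simp
  show "adj x y \<Longrightarrow> level y = level x + 1 \<or> level y = level x - 1"
    using lev[of y] lev[of x] gdist_adj_cases[of x y w] by force
  have "gdist (\<omega> 0) w = n" using geodesic_ray[of 0 n] w_def by simp
  then have "n \<le> gdist x (\<omega> 0) + gdist w x"
    using gdist_triangle[of "\<omega> 0" w x] gdist_sym[of x "\<omega> 0"] gdist_sym[of x w] by linarith
  moreover have "n > gdist x (\<omega> 0)" unfolding n_def by linarith
  ultimately have "gdist w x > 0" by linarith
  then obtain k where k: "gdist w x = Suc k" using gr0_implies_Suc by blast
  then obtain u where u: "adj x u" "gdist w u = k" using closer_neighbour by blast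
  have lev_x: "level x = int n - int (gdist w x)" and lev_u: "level u = int n - int (gdist w u)"
    using lev u by blast+
  show "\<exists>!y. adj x y \<and> level y = level x + 1"
  proof (rule ex1I[of _ u])
    show "adj x u \<and> level u = level x + 1" using lev_u lev_x u k by simp
    show "y = u" if y: "adj x y \<and> level y = level x + 1" for y
    proof -
      have "level y = int n - int (gdist w y)" using y lev by blast
      then have "gdist w x = Suc (gdist w y)" using lev_x y by linarith
      then show ?thesis by (rule closer_neighbour_unique[rotated 2]) (use y u k in simp_all)
    qed
  qed
qed

lemma adj_predecessor: "adj x (predecessor x)"
  and level_predecessor [simp]: "level (predecessor x) = level x + 1"
  using theI'[OF level_neighbours(1)[of x]] unfolding predecessor_def by auto

lemma predecessor_eqI: "adj x y \<Longrightarrow> level y = level x + 1 \<Longrightarrow> predecessor x = y"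
  unfolding predecessor_def using level_neighbours(1)[of x] by (intro the1_equality) simp_all

definition children :: "'a \<Rightarrow> 'a set" where
  "children x = {y. predecessor y = x}"

lemma neighbours_eq: "{y. adj x y} = insert (predecessor x) (children x)"
proof (intro equalityI subsetI)
  fix y assume "y \<in> {y. adj x y}"
  then have "adj x y" by simp
  from level_neighbours(2)[OF this] show "y \<in> insert (predecessor x) (children x)"
  proof
    assume "level y = level x - 1"
    then have "predecessor y = x" by (intro predecessor_eqI[OF adj_sym[OF \<open>adj x y\<close>]]) simp
    then show ?thesis by (simp add: children_def)
  next
    assume "level y = level x + 1"
    then show ?thesis using predecessor_eqI[OF \<open>adj x y\<close>] by blast
  qed
next
  fix y assume "y \<in> insert (predecessor x) (children x)"
  then show "y \<in> {y. adj x y}"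
    using adj_predecessor[of x] adj_sym[OF adj_predecessor[of y]] by (auto simp: children_def)
qed

lemma finite_children [simp]: "finite (children x)"
  using finite_neighbours[of x] unfolding neighbours_eq by auto

lemma predecessor_notin_children: "predecessor x \<notin> children x"
proof
  assume "predecessor x \<in> children x"
  then have "level (predecessor (predecessor x)) = level x" by (simp add: children_def)
  then show False by simp
qed

lemma card_children: "card (children x) = q"
  using degree[of x] predecessor_notin_children[of x] unfolding neighbours_eq by simp

lemma level_funpow [simp]: "level ((predecessor ^^ a) x) = level x + int a"
  by (induction a) auto

lemma gdist_funpow: "gdist x ((predecessor ^^ a) x) \<le> a"
proof (induction a)
  case (Suc a)
  show ?case
    using gdist_triangle[of x "predecessor ((predecessor ^^ a) x)" "(predecessor ^^ a) x"] Suc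
      gdist_adj_le[OF adj_predecessor[of "(predecessor ^^ a) x"]] by simp
qed simp

text \<open>The path runs through the common ancestor. This bound trades the weight in the distance
  for a weight in \<open>a + b\<close>.\<close>

lemma gdist_le_if_funpow_eq:
  assumes "(predecessor ^^ a) x = (predecessor ^^ b) y"
  shows "gdist x y \<le> a + b"
  using gdist_triangle[of x y "(predecessor ^^ a) x"] gdist_funpow[of x a] gdist_funpow[of y b]
    assms gdist_sym[of y] by simp

lemma card_descendants:
  "finite {x. (predecessor ^^ a) x = z} \<and> card {x. (predecessor ^^ a) x = z} = q ^ a"
proof (induction a arbitrary: z)
  case (Suc a)
  have eq: "{x. (predecessor ^^ Suc a) x = z} =
      (\<Union>y\<in>children z. {x. (predecessor ^^ a) x = y})"
    unfolding children_def by auto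
  have "card (\<Union>y\<in>children z. {x. (predecessor ^^ a) x = y}) =
      (\<Sum>y\<in>children z. card {x. (predecessor ^^ a) x = y})"
    by (rule card_UN_disjoint) (use Suc in auto)
  then show ?case unfolding eq using Suc card_children by simp
qed simp

end

section \<open>The lazy walk and ballot numbers\<close>

text \<open>The function \<open>cosh u * exp (- u^2 / 2)\<close> is 1 at 0, and its derivative has
  the sign of \<open>sinh u - u * cosh u\<close>, which is at most 0.\<close>

lemma cosh_le_exp_half_square:
  fixes x :: real
  assumes "x \<ge> 0"
  shows "cosh x \<le> exp (x\<^sup>2 / 2)"
proof -
  have 1: "sinh y \<le> y * cosh y" if "y \<ge> 0" for y :: real
  proof -
    have "0 * cosh 0 - sinh 0 \<le> y * cosh y - sinh y"
    proof (rule DERIV_nonneg_imp_nondecreasing[OF that])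
      fix u :: real assume u: "0 \<le> u" "u \<le> y"
      have "((\<lambda>u. u * cosh u - sinh u) has_real_derivative u * sinh u) (at u)"
        by (auto intro!: derivative_eq_intros)
      then show "\<exists>z. ((\<lambda>u. u * cosh u - sinh u) has_real_derivative z) (at u) \<and> 0 \<le> z"
        using u by (intro exI[of _ "u * sinh u"]) auto
    qed
    then show ?thesis by simp
  qed
  have "cosh x * exp (- (x\<^sup>2 / 2)) \<le> cosh 0 * exp (- (0\<^sup>2 / 2))"
  proof (rule DERIV_nonpos_imp_nonincreasing[OF assms])
    fix u :: real assume u: "0 \<le> u" "u \<le> x"
    have "((\<lambda>u. cosh u * exp (- (u\<^sup>2 / 2))) has_real_derivative
        (sinh u - u * cosh u) * exp (- (u\<^sup>2 / 2))) (at u)"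
      by (auto intro!: derivative_eq_intros simp: algebra_simps)
    then show "\<exists>z. ((\<lambda>u. cosh u * exp (- (u\<^sup>2 / 2))) has_real_derivative z) (at u) \<and> z \<le> 0"
      using 1[OF u(1)] by (intro exI[of _ "(sinh u - u * cosh u) * exp (- (u\<^sup>2 / 2))"])
        (auto intro: mult_nonpos_nonneg)
  qed
  then show ?thesis by (simp add: exp_minus field_simps)
qed

text \<open>
  \<open>lazy_walk N r\<close> is the probability that the lazy simple random walk on the integers is at \<open>r\<close>
  at time \<open>N\<close>.
\<close>

definition lazy_walk :: "nat \<Rightarrow> nat \<Rightarrow> real" where
  "lazy_walk N r = real (2 * N choose (N + r)) / 4 ^ N"

lemma lazy_walk_nonneg [simp]: "lazy_walk N r \<ge> 0"
  by (simp add: lazy_walk_def)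

lemma lazy_walk_eq_0: "r > N \<Longrightarrow> lazy_walk N r = 0"
  by (simp add: lazy_walk_def)

text \<open>The ratio of neighbouring binomial coefficients, free of division. It makes every
  difference in position a rational multiple of one walk probability.\<close>

lemma lazy_walk_Suc_right:
  "lazy_walk N (Suc r) * (real N + real r + 1) = lazy_walk N r * (real N - real r)"
proof (cases "r \<le> N")
  case True
  have "Suc (N + r) * (2 * N choose Suc (N + r)) = (2 * N - (N + r)) * (2 * N choose (N + r))"
    by (simp only: binomial_absorption binomial_absorb_comp)
  then have "real (Suc (N + r)) * real (2 * N choose Suc (N + r)) =
      real (2 * N - (N + r)) * real (2 * N choose (N + r))"
    by (metis of_nat_mult)
  moreover have "real (2 * N - (N + r)) = real N - real r" using True by simp
  ultimately show ?thesis unfolding lazy_walk_def by (simp add: field_simps)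
qed (simp add: lazy_walk_eq_0)

lemma lazy_walk_antimono: "r \<le> r' \<Longrightarrow> lazy_walk N r' \<le> lazy_walk N r"
proof (induction rule: dec_induct)
  case (step m)
  have "lazy_walk N (Suc m) * (real N + real m + 1) \<le> lazy_walk N m * (real N + real m + 1)"
    unfolding lazy_walk_Suc_right by (rule mult_left_mono) auto
  then have "lazy_walk N (Suc m) \<le> lazy_walk N m" by (rule mult_right_le_imp_le) simp
  then show ?case using step by simp
qed simp

text \<open>Two absorption steps link the binomial coefficients at times \<open>n + 1\<close> and
  \<open>n\<close>; this gives \<open>ballot_eq\<close> its single term.\<close>

lemma lazy_walk_Suc_Suc:
  "4 * lazy_walk (Suc n) (Suc m) * (real n + real m + 1) * (real n + real m + 2) =
     (2 * real n + 2) * (2 * real n + 1) * lazy_walk n m"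
proof -
  have "Suc (Suc (n + m)) * (Suc (Suc (2 * n)) choose Suc (Suc (n + m))) =
      Suc (Suc (2 * n)) * (Suc (2 * n) choose Suc (n + m))"
    by (rule Suc_times_binomial)
  moreover have "Suc (n + m) * (Suc (2 * n) choose Suc (n + m)) = Suc (2 * n) * (2 * n choose (n + m))"
    by (rule Suc_times_binomial)
  ultimately have "real (Suc (Suc (n + m))) * real (Suc (Suc (2 * n)) choose Suc (Suc (n + m))) =
      real (Suc (Suc (2 * n))) * real (Suc (2 * n) choose Suc (n + m))"
    "real (Suc (n + m)) * real (Suc (2 * n) choose Suc (n + m)) =
      real (Suc (2 * n)) * real (2 * n choose (n + m))"
    by (metis of_nat_mult)+
  then have "real (Suc (n + m)) * (real (Suc (Suc (n + m))) * real (Suc (Suc (2 * n)) choose Suc (Suc (n + m)))) =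
      real (Suc (Suc (2 * n))) * (real (Suc (2 * n)) * real (2 * n choose (n + m)))"
    by algebra
  then have "(real n + real m + 1) * (real n + real m + 2) * real (Suc (Suc (2 * n)) choose Suc (Suc (n + m))) =
      (2 * real n + 2) * (2 * real n + 1) * real (2 * n choose (n + m))"
    by (simp add: add_ac mult_ac)
  moreover have "4 * lazy_walk (Suc n) (Suc m) = real (Suc (Suc (2 * n)) choose Suc (Suc (n + m))) / 4 ^ n"
    "lazy_walk n m = real (2 * n choose (n + m)) / 4 ^ n"
    by (simp_all add: lazy_walk_def del: binomial_Suc_Suc)
  ultimately show ?thesis by (simp only: times_divide_eq_right times_divide_eq_left mult_ac)
qed

text \<open>By the binomial theorem the two-sided sum is
  \<open>cosh (\<kappa> / 2) ^ (2 * N)\<close>, which has a Gaussian bound.\<close>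

lemma lazy_walk_exp_moment:
  assumes "\<kappa> \<ge> 0"
  shows "(\<Sum>r<K. lazy_walk N r * exp (\<kappa> * real r)) \<le> exp (\<kappa>\<^sup>2 * real N / 4)"
proof -
  have "(\<Sum>r<K. lazy_walk N r * exp (\<kappa> * real r)) =
      (\<Sum>r\<in>{..<K} \<inter> {..N}. lazy_walk N r * exp (\<kappa> * real r))"
    by (rule sum.mono_neutral_right) (auto, metis lazy_walk_eq_0 not_le)
  also have "\<dots> \<le> (\<Sum>r\<le>N. lazy_walk N r * exp (\<kappa> * real r))"
    by (rule sum_mono2) auto
  \<comment> \<open>The index \<open>j = N + r\<close> counts the successes in \<open>2 * N\<close>
    fair coin flips.\<close>
  also have "\<dots> = (\<Sum>j=N..2*N. real (2 * N choose j) * exp (\<kappa> * (real j - real N)) / 4 ^ N)"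
    by (rule sum.reindex_bij_witness[of _ "\<lambda>j. j - N" "\<lambda>r. N + r"])
      (auto simp: lazy_walk_def)
  \<comment> \<open>The added terms \<open>j < N\<close> belong to the negative positions.\<close>
  also have "\<dots> \<le> (\<Sum>j\<le>2*N. real (2 * N choose j) * exp (\<kappa> * (real j - real N)) / 4 ^ N)"
    by (rule sum_mono2) auto
  also have "\<dots> = (\<Sum>j\<le>2*N. real (2 * N choose j) * exp \<kappa> ^ j * 1 ^ (2 * N - j)) * exp (- \<kappa> * real N) / 4 ^ N"
    unfolding sum_distrib_right sum_divide_distrib
    by (intro sum.cong refl) (simp add: exp_of_nat_mult[symmetric] exp_diff exp_minus field_simps)
  also have "\<dots> = (exp \<kappa> + 1) ^ (2 * N) * exp (- \<kappa> * real N) / 4 ^ N"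
    by (subst binomial_ring) simp
  also have "\<dots> = ((exp \<kappa> + 1)\<^sup>2 * exp (- \<kappa>) / 4) ^ N"
  proof -
    have "(exp \<kappa> + 1) ^ (2 * N) = ((exp \<kappa> + 1)\<^sup>2) ^ N" by (rule power_mult)
    moreover have "exp (- \<kappa> * real N) = exp (- \<kappa>) ^ N"
      by (simp add: exp_of_nat_mult[symmetric] mult.commute)
    ultimately show ?thesis by (simp only: power_mult_distrib power_divide)
  qed
  also have "(exp \<kappa> + 1)\<^sup>2 * exp (- \<kappa>) / 4 = (cosh (\<kappa> / 2))\<^sup>2"
  proof -
    define z where "z = exp (\<kappa> / 2)"
    have z: "exp \<kappa> = z\<^sup>2" "z > 0" unfolding z_def by (simp_all flip: exp_double)
    show ?thesis
      unfolding cosh_field_def exp_minus z z_def[symmetric] using z(2)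
      by (simp add: field_simps power2_eq_square)
  qed
  also have "((cosh (\<kappa> / 2))\<^sup>2) ^ N \<le> ((exp ((\<kappa> / 2)\<^sup>2 / 2))\<^sup>2) ^ N"
    using cosh_le_exp_half_square[of "\<kappa> / 2"] assms by (intro power_mono) auto
  also have "\<dots> = exp (\<kappa>\<^sup>2 * real N / 4)"
    by (simp flip: exp_of_nat_mult power_mult add: power_divide field_simps)
  finally show ?thesis .
qed

text \<open>
  The probability that the lazy walk is at \<open>m\<close> at time \<open>n\<close> without having visited \<open>-1\<close>
  (the reflection principle).
\<close>

definition ballot :: "nat \<Rightarrow> nat \<Rightarrow> real" where
  "ballot n m = lazy_walk n m - lazy_walk n (m + 2)"

text \<open>The ballot theorem: the difference collapses to one walk probability, one time step
  later. The estimates of differences below start from this product form.\<close>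

lemma ballot_eq: "ballot n m = 4 / (real n + 1) * ((real m + 1) * lazy_walk (Suc n) (Suc m))"
proof -
  \<comment> \<open>The common denominator of the two ratio steps from position \<open>m\<close> to
    \<open>m + 2\<close>.\<close>
  define c where "c = (real n + real m + 1) * (real n + real m + 2)"
  have c: "c > 0" unfolding c_def by (intro mult_pos_pos) simp_all
  have 1: "lazy_walk n (Suc m) * (real n + real m + 1) = lazy_walk n m * (real n - real m)"
    by (rule lazy_walk_Suc_right)
  have 2: "lazy_walk n (m + 2) * (real n + real m + 2) = lazy_walk n (Suc m) * (real n - real m - 1)"
    using lazy_walk_Suc_right[of n "Suc m"] by (simp add: algebra_simps)
  have "lazy_walk n (m + 2) * c =
      (lazy_walk n (m + 2) * (real n + real m + 2)) * (real n + real m + 1)"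
    unfolding c_def by simp
  also have "\<dots> = (lazy_walk n (Suc m) * (real n + real m + 1)) * (real n - real m - 1)"
    unfolding 2 by simp
  also have "\<dots> = lazy_walk n m * (real n - real m) * (real n - real m - 1)"
    unfolding 1 by simp
  finally have 3: "lazy_walk n (m + 2) * c = lazy_walk n m * (real n - real m) * (real n - real m - 1)" .
  have "(ballot n m * (real n + 1)) * c = (4 * (real m + 1) * lazy_walk (Suc n) (Suc m)) * c"
    using lazy_walk_Suc_Suc[of n m] 3 unfolding ballot_def c_def by algebra
  then have "ballot n m * (real n + 1) = 4 * (real m + 1) * lazy_walk (Suc n) (Suc m)"
    using c by simp
  then show ?thesis by (simp add: field_simps)
qed

lemma ballot_nonneg [simp]: "ballot n m \<ge> 0"
  unfolding ballot_eq by simp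

lemma ballot_0: "ballot 0 m = (if m = 0 then 1 else 0)"
  by (simp add: ballot_def lazy_walk_def binomial_eq_0)

text \<open>Pascal's rule twice: the walk moves by -1, 0, 1 with probabilities 1/4, 1/2,
  1/4.\<close>

lemma lazy_walk_Suc_left:
  "4 * lazy_walk (Suc n) (Suc m) = lazy_walk n m + 2 * lazy_walk n (Suc m) + lazy_walk n (Suc (Suc m))"
  by (simp add: lazy_walk_def field_simps)

lemma lazy_walk_Suc_0: "4 * lazy_walk (Suc n) 0 = 2 * lazy_walk n 0 + 2 * lazy_walk n 1"
proof (cases n)
  case (Suc k)
  \<comment> \<open>The symmetry of the walk, which identifies the positions -1 and 1.\<close>
  have "(2 * n choose k) = (2 * n choose Suc n)"
    using binomial_symmetric[of k "2 * n"] Suc by (simp add: algebra_simps)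
  then show ?thesis by (simp add: lazy_walk_def field_simps Suc)
qed (simp add: lazy_walk_def)

text \<open>The position -1 contributes nothing, because the reflection makes the difference vanish
  there.\<close>

lemma ballot_Suc_0: "ballot (Suc n) 0 = ballot n 0 / 2 + ballot n 1 / 4"
  using lazy_walk_Suc_0[of n] lazy_walk_Suc_left[of n 1]
  by (simp add: ballot_def numeral_2_eq_2 numeral_3_eq_3 field_simps)

lemma ballot_Suc_Suc:
  "ballot (Suc n) (Suc m) = ballot n (Suc m) / 2 + (ballot n m + ballot n (Suc (Suc m))) / 4"
  using lazy_walk_Suc_left[of n m] lazy_walk_Suc_left[of n "m + 2"]
  by (simp add: ballot_def field_simps)

text \<open>The factor \<open>m + 1\<close> of \<open>ballot_eq\<close>, of order
  \<open>sqrt n\<close> on the diffusive scale, is replaced by one that is bounded there: a gain of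
  \<open>sqrt n\<close>.\<close>

lemma ballot_diff1:
  "ballot n (Suc r) - ballot n r = 4 / (real n + 1) *
     (lazy_walk (Suc n) (Suc r) * (real n + 1 - 2 * (real r + 1) * (real r + 2)) / (real n + real r + 3))"
proof -
  have 1: "lazy_walk (Suc n) (Suc (Suc r)) * (real n + real r + 3) = lazy_walk (Suc n) (Suc r) * (real n - real r)"
    using lazy_walk_Suc_right[of "Suc n" "Suc r"] by (simp add: algebra_simps)
  have p: "real n + real r + 3 > 0" by simp
  have "((real r + 2) * lazy_walk (Suc n) (Suc (Suc r)) - (real r + 1) * lazy_walk (Suc n) (Suc r)) *
      (real n + real r + 3) =
      lazy_walk (Suc n) (Suc r) * (real n + 1 - 2 * (real r + 1) * (real r + 2))"
    using 1 by algebra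
  then have "(real r + 2) * lazy_walk (Suc n) (Suc (Suc r)) - (real r + 1) * lazy_walk (Suc n) (Suc r) =
      lazy_walk (Suc n) (Suc r) * (real n + 1 - 2 * (real r + 1) * (real r + 2)) / (real n + real r + 3)"
    using p by (simp add: eq_divide_eq)
  then show ?thesis unfolding ballot_eq by (simp add: right_diff_distrib algebra_simps)
qed

text \<open>Two ratio steps. For \<open>r\<close> of order \<open>sqrt n\<close> the rational factor
  is of order \<open>1 / sqrt n\<close>, a second gain of \<open>sqrt n\<close>.\<close>

lemma ballot_diff2:
  "ballot n (Suc (Suc r)) - 2 * ballot n (Suc r) + ballot n r = 4 / (real n + 1) *
     (lazy_walk (Suc n) (Suc r) * ((real r + 2) * (4 * (real r + 1) * (real r + 3) - 6 * (real n + 1)))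
       / ((real n + real r + 3) * (real n + real r + 4)))"
proof -
  define c where "c = (real n + real r + 3) * (real n + real r + 4)"
  have c: "c > 0" unfolding c_def by (intro mult_pos_pos) simp_all
  have 1: "lazy_walk (Suc n) (Suc (Suc r)) * (real n + real r + 3) = lazy_walk (Suc n) (Suc r) * (real n - real r)"
    using lazy_walk_Suc_right[of "Suc n" "Suc r"] by (simp add: algebra_simps)
  have 2: "lazy_walk (Suc n) (Suc (Suc (Suc r))) * (real n + real r + 4) = lazy_walk (Suc n) (Suc (Suc r)) * (real n - real r - 1)"
    using lazy_walk_Suc_right[of "Suc n" "Suc (Suc r)"] by (simp add: algebra_simps)
  have "((real r + 3) * lazy_walk (Suc n) (Suc (Suc (Suc r))) - 2 * ((real r + 2) * lazy_walk (Suc n) (Suc (Suc r)))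
      + (real r + 1) * lazy_walk (Suc n) (Suc r)) * c =
      lazy_walk (Suc n) (Suc r) * ((real r + 2) * (4 * (real r + 1) * (real r + 3) - 6 * (real n + 1)))"
    using 1 2 unfolding c_def by algebra
  then have "(real r + 3) * lazy_walk (Suc n) (Suc (Suc (Suc r))) - 2 * ((real r + 2) * lazy_walk (Suc n) (Suc (Suc r)))
      + (real r + 1) * lazy_walk (Suc n) (Suc r) =
      lazy_walk (Suc n) (Suc r) * ((real r + 2) * (4 * (real r + 1) * (real r + 3) - 6 * (real n + 1))) / c"
    using c by (simp add: eq_divide_eq)
  moreover have "ballot n (Suc (Suc r)) - 2 * ballot n (Suc r) + ballot n r = 4 / (real n + 1) *
      ((real r + 3) * lazy_walk (Suc n) (Suc (Suc (Suc r))) - 2 * ((real r + 2) * lazy_walk (Suc n) (Suc (Suc r)))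
      + (real r + 1) * lazy_walk (Suc n) (Suc r))"
    unfolding ballot_eq by (simp add: distrib_left right_diff_distrib add_ac)
  ultimately show ?thesis unfolding c_def by simp
qed

section \<open>Weighted sums of differences of ballot numbers\<close>

text \<open>
  The operators on coefficient arrays that correspond to the flow gradients in the two variables.
\<close>

definition diff_fst :: "(nat \<times> nat \<Rightarrow> real) \<Rightarrow> nat \<times> nat \<Rightarrow> real" where
  "diff_fst c = (\<lambda>(a, b). c (a, b) - (case a of 0 \<Rightarrow> 0 | Suc a' \<Rightarrow> c (a', b)))"

definition diff_snd :: "(nat \<times> nat \<Rightarrow> real) \<Rightarrow> nat \<times> nat \<Rightarrow> real" where
  "diff_snd c = (\<lambda>(a, b). c (a, b) - (case b of 0 \<Rightarrow> 0 | Suc b' \<Rightarrow> c (a, b')))"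

definition ballot2 :: "nat \<Rightarrow> nat \<times> nat \<Rightarrow> real" where
  "ballot2 n = (\<lambda>(a, b). ballot n (a + b))"

text \<open>
  Below, \<open>w\<close> serves to absorb polynomial factors: \<open>(k + 1) / s \<le> w\<close>.
\<close>

context
  fixes n k :: nat and s w \<beta> :: real
  defines "s \<equiv> sqrt (real n + 1)" and "w \<equiv> exp (real k / s)"
    and "\<beta> \<equiv> lazy_walk (Suc n) (k - 1)"
begin

text \<open>The last bound is \<open>1 + u \<le> exp u\<close> at \<open>u = k / s\<close>. The
  position \<open>k - 1\<close> in \<open>\<beta>\<close> is the lowest one needed for a row
  \<open>a + b = k\<close>, namely in the second difference; as the walk is antimonotone,
  \<open>\<beta>\<close> bounds the other values too.\<close>

lemma scale_bounds:
  shows "s \<ge> 1" "s\<^sup>2 = real n + 1" "w \<ge> 1" "\<beta> \<ge> 0" "real k + 1 \<le> s * w"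
proof -
  show s: "s \<ge> 1" "s\<^sup>2 = real n + 1" by (simp_all add: s_def)
  show "w \<ge> 1" using s by (simp add: w_def)
  show "\<beta> \<ge> 0" by (simp add: \<beta>_def)
  have "real k + 1 \<le> s * (1 + real k / s)" using s by (simp add: field_simps)
  also have "\<dots> \<le> s * w" unfolding w_def using s exp_ge_add_one_self by (intro mult_left_mono) auto
  finally show "real k + 1 \<le> s * w" .
qed

lemma ballot_le: "ballot n k \<le> 4 * w * \<beta> / s"
proof -
  have "ballot n k = 4 / s\<^sup>2 * ((real k + 1) * lazy_walk (Suc n) (Suc k))"
    unfolding ballot_eq scale_bounds ..
  also have "\<dots> \<le> 4 / s\<^sup>2 * ((s * w) * \<beta>)"
    unfolding \<beta>_def using scale_bounds lazy_walk_antimono[of "k - 1" "Suc k" "Suc n"]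
    by (intro mult_left_mono mult_mono) auto
  also have "\<dots> = 4 * w * \<beta> / s" using scale_bounds(1) by (simp add: power2_eq_square)
  finally show ?thesis .
qed

lemma ballot_diff1_le:
  assumes "k > 0"
  shows "\<bar>ballot n k - ballot n (k - 1)\<bar> \<le> 12 * w\<^sup>2 * \<beta> / s\<^sup>2"
proof -
  obtain r where k: "k = Suc r" using assms by (cases k) auto
  have x: "(real k + 1)\<^sup>2 \<le> (s * w)\<^sup>2" using scale_bounds by (intro power_mono) auto
  have y: "s\<^sup>2 \<le> (s * w)\<^sup>2" using scale_bounds by (intro power_mono) auto
  have "\<bar>real n + 1 - 2 * (real r + 1) * (real r + 2)\<bar> \<le> s\<^sup>2 + 2 * (real k + 1)\<^sup>2"
    unfolding scale_bounds k by (simp add: abs_le_iff power2_eq_square algebra_simps)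
  also have "\<dots> \<le> 3 * (s * w)\<^sup>2" using x y by linarith
  also have "\<dots> = s\<^sup>2 * (3 * w\<^sup>2)" by (simp add: power_mult_distrib)
  finally have 1: "\<bar>real n + 1 - 2 * (real r + 1) * (real r + 2)\<bar> \<le> s\<^sup>2 * (3 * w\<^sup>2)" .
  have "\<bar>ballot n k - ballot n (k - 1)\<bar> = 4 / s\<^sup>2 *
      (lazy_walk (Suc n) (Suc r) * (\<bar>real n + 1 - 2 * (real r + 1) * (real r + 2)\<bar> / (real n + real r + 3)))"
    unfolding k diff_Suc_1 ballot_diff1 scale_bounds by (simp add: abs_mult)
  also have "\<dots> \<le> 4 / s\<^sup>2 * (\<beta> * (s\<^sup>2 * (3 * w\<^sup>2) / s\<^sup>2))"
    unfolding \<beta>_def using scale_bounds 1 lazy_walk_antimono[of "k - 1" "Suc r" "Suc n"] k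
    by (intro mult_left_mono mult_mono frac_le) auto
  also have "\<dots> = 12 * w\<^sup>2 * \<beta> / s\<^sup>2" using scale_bounds by simp
  finally show ?thesis .
qed

lemma ballot_diff2_le:
  assumes "k > 1"
  shows "real k * \<bar>ballot n k - 2 * ballot n (k - 1) + ballot n (k - 2)\<bar> \<le> 40 * w ^ 4 * \<beta> / s\<^sup>2"
proof -
  obtain r where k: "k = Suc (Suc r)" using assms by (metis less_imp_Suc_add add_Suc_right One_nat_def add_Suc)
  have x: "(real k + 1)\<^sup>2 \<le> (s * w)\<^sup>2" using scale_bounds by (intro power_mono) auto
  have y: "s\<^sup>2 \<le> (s * w)\<^sup>2" using scale_bounds by (intro power_mono) auto
  define D where "D = (real n + real r + 3) * (real n + real r + 4)"
  have "D > 0" unfolding D_def by (intro mult_pos_pos) simp_all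
  have D: "D \<ge> s\<^sup>2 * s\<^sup>2" unfolding scale_bounds D_def by (intro mult_mono) auto
  have "\<bar>4 * (real r + 1) * (real r + 3) - 6 * (real n + 1)\<bar> \<le> 6 * s\<^sup>2 + 4 * (real k + 1)\<^sup>2"
    unfolding scale_bounds k by (simp add: abs_le_iff power2_eq_square algebra_simps)
  also have "\<dots> \<le> 10 * (s * w)\<^sup>2" using x y by linarith
  also have "\<dots> = s\<^sup>2 * (10 * w\<^sup>2)" by (simp add: power_mult_distrib)
  finally have 1: "\<bar>4 * (real r + 1) * (real r + 3) - 6 * (real n + 1)\<bar> \<le> s\<^sup>2 * (10 * w\<^sup>2)" .
  \<comment> \<open>The factor \<open>k\<close>, which bounds the number of interior entries of a
    row, pairs with \<open>r + 2 = k\<close> from the second difference.\<close>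
  have 2: "real k * (real r + 2) \<le> (s * w)\<^sup>2"
    using x unfolding k by (simp add: power2_eq_square algebra_simps)
  have "real k * \<bar>ballot n k - 2 * ballot n (k - 1) + ballot n (k - 2)\<bar> = 4 / s\<^sup>2 *
      (lazy_walk (Suc n) (Suc r) * ((real k * (real r + 2)) * \<bar>4 * (real r + 1) * (real r + 3) - 6 * (real n + 1)\<bar> / D))"
    using ballot_diff2[of n r] unfolding k scale_bounds D_def by (simp add: abs_mult numeral_2_eq_2)
  also have "\<dots> \<le> 4 / s\<^sup>2 * (\<beta> * ((s * w)\<^sup>2 * (s\<^sup>2 * (10 * w\<^sup>2)) / (s\<^sup>2 * s\<^sup>2)))"
    unfolding \<beta>_def using scale_bounds 1 2 D \<open>D > 0\<close> lazy_walk_antimono[of "k - 1" "Suc r" "Suc n"] k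
    by (intro mult_left_mono mult_mono frac_le) auto
  also have "\<dots> = 40 * w ^ 4 * \<beta> / s\<^sup>2"
    using scale_bounds(1) by (simp add: field_simps power2_eq_square power4_eq_xxxx)
  finally show ?thesis .
qed

text \<open>All entries of the row equal \<open>ballot n k\<close>. The four row bounds share the
  form \<open>64 * w ^ 4 * \<beta> / s ^ j\<close>, with \<open>j\<close> the number of differences
  taken, so that one summation serves them all.\<close>

lemma row_ballot2: "(\<Sum>i\<le>k. \<bar>ballot2 n (i, k - i)\<bar>) \<le> 64 * w ^ 4 * \<beta> / s ^ 0"
proof -
  have "(\<Sum>i\<le>k. \<bar>ballot2 n (i, k - i)\<bar>) = (real k + 1) * ballot n k"
    by (simp add: ballot2_def)
  also have "\<dots> \<le> (s * w) * (4 * w * \<beta> / s)"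
    using scale_bounds ballot_le by (intro mult_mono) auto
  also have "\<dots> = 4 * w ^ 2 * \<beta>" using scale_bounds(1) by (simp add: power2_eq_square)
  also have "\<dots> \<le> 64 * w ^ 4 * \<beta>"
    using scale_bounds power_increasing[of 2 4 w] by (intro mult_right_mono mult_mono) auto
  finally show ?thesis by simp
qed

text \<open>This is a row of a differenced array: one boundary entry, from which nothing is
  subtracted, and \<open>k\<close> equal others. Being single, the boundary entry also has order
  \<open>1 / s\<close>.\<close>

lemma row_first:
  "ballot n k + real k * \<bar>ballot n k - ballot n (k - 1)\<bar> \<le> 64 * w ^ 4 * \<beta> / s ^ 1"
proof -
  have "real k * \<bar>ballot n k - ballot n (k - 1)\<bar> \<le> (s * w) * (12 * w\<^sup>2 * \<beta> / s\<^sup>2)"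
  proof (cases "k = 0")
    case False
    then show ?thesis
      using scale_bounds ballot_diff1_le by (intro mult_mono) auto
  qed (use scale_bounds in simp)
  also have "\<dots> = 12 * w ^ 3 * \<beta> / s"
    using scale_bounds(1) by (simp add: field_simps power2_eq_square power3_eq_cube)
  also have "\<dots> \<le> 12 * w ^ 4 * \<beta> / s"
    using scale_bounds power_increasing[of 3 4 w] by (intro divide_right_mono mult_right_mono mult_left_mono) auto
  finally have 1: "real k * \<bar>ballot n k - ballot n (k - 1)\<bar> \<le> 12 * w ^ 4 * \<beta> / s" .
  have "4 * w * \<beta> / s \<le> 4 * w ^ 4 * \<beta> / s"
    using scale_bounds power_increasing[of 1 4 w] by (intro divide_right_mono mult_right_mono mult_left_mono) auto
  then have "ballot n k \<le> 4 * w ^ 4 * \<beta> / s" using ballot_le by (rule order_trans[rotated])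
  then have "ballot n k + real k * \<bar>ballot n k - ballot n (k - 1)\<bar> \<le>
      4 * w ^ 4 * \<beta> / s + 12 * w ^ 4 * \<beta> / s"
    using 1 by (rule add_mono)
  also have "\<dots> = 16 * (w ^ 4 * \<beta> / s)" by (simp flip: add_divide_distrib distrib_right)
  also have "\<dots> \<le> 64 * (w ^ 4 * \<beta> / s)"
    using scale_bounds by (intro mult_right_mono) auto
  finally show ?thesis by simp
qed

lemma row_diff_fst: "(\<Sum>i\<le>k. \<bar>diff_fst (ballot2 n) (i, k - i)\<bar>) \<le> 64 * w ^ 4 * \<beta> / s ^ 1"
proof -
  have "(\<Sum>i\<le>k. \<bar>diff_fst (ballot2 n) (i, k - i)\<bar>) = \<bar>diff_fst (ballot2 n) (0, k)\<bar> +
      (\<Sum>i<k. \<bar>diff_fst (ballot2 n) (Suc i, k - Suc i)\<bar>)"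
    by (subst sum.atMost_shift) simp
  also have "(\<Sum>i<k. \<bar>diff_fst (ballot2 n) (Suc i, k - Suc i)\<bar>) =
      (\<Sum>i<k. \<bar>ballot n k - ballot n (k - 1)\<bar>)"
    by (intro sum.cong refl) (auto simp: diff_fst_def ballot2_def)
  finally show ?thesis using row_first by (simp add: diff_fst_def ballot2_def)
qed

text \<open>Reversing a row exchanges the two difference operators, since \<open>ballot2\<close> is
  symmetric.\<close>

lemma row_diff_snd: "(\<Sum>i\<le>k. \<bar>diff_snd (ballot2 n) (i, k - i)\<bar>) \<le> 64 * w ^ 4 * \<beta> / s ^ 1"
proof -
  have "(\<Sum>i\<le>k. \<bar>diff_snd (ballot2 n) (i, k - i)\<bar>) =
      (\<Sum>i\<le>k. \<bar>diff_fst (ballot2 n) (i, k - i)\<bar>)"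
    by (rule sum.reindex_bij_witness[of _ "\<lambda>i. k - i" "\<lambda>i. k - i"])
      (auto simp: diff_fst_def diff_snd_def ballot2_def add.commute split: nat.split)
  then show ?thesis using row_diff_fst by simp
qed

lemma row_diff_snd_diff_fst:
  "(\<Sum>i\<le>k. \<bar>diff_snd (diff_fst (ballot2 n)) (i, k - i)\<bar>) \<le> 64 * w ^ 4 * \<beta> / s ^ 2"
proof (cases k)
  case 0
  \<comment> \<open>The corner entry is not differenced, but the factor \<open>k + 1\<close> of
    \<open>ballot_eq\<close> is 1 here, so it already has order \<open>1 / s^2\<close>.\<close>
  have "ballot n k = 4 / s\<^sup>2 * ((real k + 1) * lazy_walk (Suc n) (Suc k))"
    unfolding ballot_eq scale_bounds ..
  also have "\<dots> \<le> 4 / s\<^sup>2 * (1 * \<beta>)"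
    using scale_bounds lazy_walk_antimono[of "k - 1" "Suc k" "Suc n"] 0 unfolding \<beta>_def
    by (intro mult_left_mono) auto
  also have "\<dots> \<le> 64 / s\<^sup>2 * (w ^ 4 * \<beta>)"
    using scale_bounds one_le_power[of w 4] by (intro mult_mono divide_right_mono) auto
  finally show ?thesis by (simp add: 0 diff_fst_def diff_snd_def ballot2_def)
next
  case (Suc r)
  define d where "d = \<bar>ballot n k - ballot n (k - 1)\<bar>"
  define e where "e = \<bar>ballot n k - 2 * ballot n (k - 1) + ballot n (k - 2)\<bar>"
  \<comment> \<open>At the two ends of the row only one difference acts; the \<open>k - 1\<close>
    entries between carry a second difference. Their bounds 24 and 40 add up to the constant
    64.\<close>
  have "(\<Sum>i\<le>k. \<bar>diff_snd (diff_fst (ballot2 n)) (i, k - i)\<bar>) =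
      \<bar>diff_snd (diff_fst (ballot2 n)) (0, k)\<bar> +
      (\<Sum>i<r. \<bar>diff_snd (diff_fst (ballot2 n)) (Suc i, r - i)\<bar>) +
      \<bar>diff_snd (diff_fst (ballot2 n)) (k, 0)\<bar>"
    unfolding Suc by (subst sum.atMost_shift) (simp add: lessThan_Suc)
  also have "(\<Sum>i<r. \<bar>diff_snd (diff_fst (ballot2 n)) (Suc i, r - i)\<bar>) = (\<Sum>i<r. e)"
  proof (intro sum.cong refl)
    fix i assume "i \<in> {..<r}"
    then obtain j where j: "r = Suc (i + j)" using less_imp_Suc_add by auto
    then show "\<bar>diff_snd (diff_fst (ballot2 n)) (Suc i, r - i)\<bar> = e"
      unfolding e_def Suc by (simp add: diff_fst_def diff_snd_def ballot2_def algebra_simps)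
  qed
  also have "\<bar>diff_snd (diff_fst (ballot2 n)) (0, k)\<bar> = d"
    by (simp add: Suc d_def diff_fst_def diff_snd_def ballot2_def)
  also have "\<bar>diff_snd (diff_fst (ballot2 n)) (k, 0)\<bar> = d"
    by (simp add: Suc d_def diff_fst_def diff_snd_def ballot2_def)
  also have "d + (\<Sum>i<r. e) + d = 2 * d + real r * e" by simp
  also have "real r * e \<le> 40 * w ^ 4 * \<beta> / s\<^sup>2"
  proof (cases "r = 0")
    case False
    then have "real r * e \<le> real k * e" using Suc by (intro mult_right_mono) (auto simp: e_def)
    then show ?thesis using ballot_diff2_le False Suc unfolding e_def by linarith
  qed (use scale_bounds in simp)
  also have "2 * d \<le> 2 * (12 * w ^ 2 * \<beta> / s\<^sup>2)"
    using ballot_diff1_le Suc by (simp add: d_def)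
  also have "\<dots> \<le> 2 * (12 * w ^ 4 * \<beta> / s\<^sup>2)"
    using scale_bounds power_increasing[of 2 4 w]
    by (intro mult_left_mono divide_right_mono mult_right_mono) auto
  finally show ?thesis by (simp add: mult_ac)
qed

end

text \<open>Summation along antidiagonals, with the factor \<open>w ^ 4\<close> absorbed into the
  exponential weight, leaves an exponential moment of the walk at time \<open>n + 1\<close>.\<close>

lemma array_sum_le:
  fixes c :: "nat \<times> nat \<Rightarrow> real"
  assumes rows: "\<And>k. (\<Sum>i\<le>k. \<bar>c (i, k - i)\<bar>) \<le>
      64 * exp (real k / sqrt (real n + 1)) ^ 4 * lazy_walk (Suc n) (k - 1) / sqrt (real n + 1) ^ j"
    and \<Lambda>: "\<Lambda> \<ge> 0" and F: "finite F"
  shows "(\<Sum>(a, b)\<in>F. \<bar>c (a, b)\<bar> * exp (\<Lambda> * (real a + real b))) \<le>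
    64 * (1 + exp (\<Lambda> + 4)) * exp 8 * exp (\<Lambda>\<^sup>2 / 2 * (real n + 1)) / sqrt (real n + 1) ^ j"
proof -
  define s where "s = sqrt (real n + 1)"
  \<comment> \<open>The summand \<open>4 / s\<close> is the exponential rate of
    \<open>w ^ 4\<close>.\<close>
  define \<kappa> where "\<kappa> = \<Lambda> + 4 / s"
  have s: "s \<ge> 1" "s\<^sup>2 = real n + 1" by (simp_all add: s_def)
  have \<kappa>: "\<kappa> \<ge> 0" "\<kappa> \<le> \<Lambda> + 4" using s \<Lambda> by (simp_all add: \<kappa>_def field_simps)
  define f where "f = (\<lambda>(a, b). \<bar>c (a, b)\<bar> * exp (\<Lambda> * (real a + real b)))"
  define K where "K = Suc (Max ((\<lambda>(a, b). a + b) ` F))"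
  have sub: "F \<subseteq> {(i, j). i + j < K}"
  proof
    fix p assume p: "p \<in> F"
    then have "(\<lambda>(a, b). a + b) p \<le> Max ((\<lambda>(a, b). a + b) ` F)" using F by (intro Max_ge) auto
    then show "p \<in> {(i, j). i + j < K}" unfolding K_def by auto
  qed
  have fin: "finite {(i, j). i + j < K}"
    by (rule finite_subset[of _ "{..K} \<times> {..K}"]) auto
  have "sum f F \<le> sum f {(i, j). i + j < K}"
    using sub fin by (intro sum_mono2) (auto simp: f_def)
  also have "\<dots> = (\<Sum>k<K. \<Sum>i\<le>k. f (i, k - i))"
    using sum.triangle_reindex[of "\<lambda>i j. f (i, j)" K] by (simp add: case_prod_unfold)
  also have "\<dots> = (\<Sum>k<K. (\<Sum>i\<le>k. \<bar>c (i, k - i)\<bar>) * exp (\<Lambda> * real k))"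
    by (intro sum.cong refl) (auto simp: f_def sum_distrib_right of_nat_diff intro!: sum.cong)
  also have "\<dots> \<le> (\<Sum>k<K. (64 / s ^ j) * (lazy_walk (Suc n) (k - 1) * exp (\<kappa> * real k)))"
  proof (intro sum_mono)
    fix k
    have "exp (real k / s) ^ 4 * exp (\<Lambda> * real k) = exp (\<kappa> * real k)"
      unfolding \<kappa>_def by (simp flip: exp_of_nat_mult exp_add add: algebra_simps)
    then have "(64 * exp (real k / s) ^ 4 * lazy_walk (Suc n) (k - 1) / s ^ j) * exp (\<Lambda> * real k) =
        (64 / s ^ j) * (lazy_walk (Suc n) (k - 1) * exp (\<kappa> * real k))"
      by (simp add: field_simps)
    moreover have "(\<Sum>i\<le>k. \<bar>c (i, k - i)\<bar>) * exp (\<Lambda> * real k) \<le>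
        (64 * exp (real k / s) ^ 4 * lazy_walk (Suc n) (k - 1) / s ^ j) * exp (\<Lambda> * real k)"
      by (rule mult_right_mono[OF rows[folded s_def]]) simp
    ultimately show "(\<Sum>i\<le>k. \<bar>c (i, k - i)\<bar>) * exp (\<Lambda> * real k) \<le>
        (64 / s ^ j) * (lazy_walk (Suc n) (k - 1) * exp (\<kappa> * real k))" by (rule ord_le_eq_trans[rotated])
  qed
  also have "\<dots> = (64 / s ^ j) * (\<Sum>k<K. lazy_walk (Suc n) (k - 1) * exp (\<kappa> * real k))"
    by (rule sum_distrib_left[symmetric])
  also have "\<dots> \<le> (64 / s ^ j) * ((1 + exp (\<Lambda> + 4)) * exp (\<kappa>\<^sup>2 * real (Suc n) / 4))"
  proof (rule mult_left_mono)
    \<comment> \<open>As \<open>0 - 1 = 0\<close> on naturals, the walk at 0 occurs for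
      \<open>k = 0\<close> and, if \<open>K > 1\<close>, again for \<open>k = 1\<close>. The first
      occurrence gives the summand 1, the shift in the others the factor
      \<open>exp \<kappa>\<close>.\<close>
    have K: "K = Suc (K - 1)" by (simp add: K_def)
    have "(\<Sum>k<K. lazy_walk (Suc n) (k - 1) * exp (\<kappa> * real k)) =
        lazy_walk (Suc n) 0 + (\<Sum>k<K - 1. lazy_walk (Suc n) k * exp (\<kappa> * real (Suc k)))"
      by (subst K) (simp add: sum.lessThan_Suc_shift del: sum.lessThan_Suc)
    also have "\<dots> = (\<Sum>r<1. lazy_walk (Suc n) r * exp (\<kappa> * real r)) +
        exp \<kappa> * (\<Sum>k<K - 1. lazy_walk (Suc n) k * exp (\<kappa> * real k))"
      by (simp add: sum_distrib_left distrib_left exp_add mult_ac)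
    also have "\<dots> \<le> exp (\<kappa>\<^sup>2 * real (Suc n) / 4) + exp (\<Lambda> + 4) * exp (\<kappa>\<^sup>2 * real (Suc n) / 4)"
      using \<kappa> by (intro add_mono mult_mono lazy_walk_exp_moment) (auto intro: sum_nonneg)
    finally show "(\<Sum>k<K. lazy_walk (Suc n) (k - 1) * exp (\<kappa> * real k)) \<le>
        (1 + exp (\<Lambda> + 4)) * exp (\<kappa>\<^sup>2 * real (Suc n) / 4)"
      by (simp add: algebra_simps)
  qed (use s in simp)
  also have "\<dots> \<le> (64 / s ^ j) * ((1 + exp (\<Lambda> + 4)) * (exp 8 * exp (\<Lambda>\<^sup>2 / 2 * (real n + 1))))"
  proof (intro mult_left_mono)
    \<comment> \<open>As \<open>s^2 = n + 1\<close>, the part of \<open>\<kappa>\<close> coming from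
      \<open>w ^ 4\<close> contributes only the constant 8 to the exponent.\<close>
    have "\<kappa>\<^sup>2 \<le> 2 * \<Lambda>\<^sup>2 + 2 * (4 / s)\<^sup>2"
      using zero_le_power2[of "\<Lambda> - 4 / s"] unfolding \<kappa>_def power2_diff power2_sum by linarith
    also have "(4 / s)\<^sup>2 = 16 / (real n + 1)" using s by (simp add: power_divide)
    finally have "\<kappa>\<^sup>2 * real (Suc n) / 4 \<le> 8 + \<Lambda>\<^sup>2 / 2 * (real n + 1)"
      by (simp add: field_simps)
    then show "exp (\<kappa>\<^sup>2 * real (Suc n) / 4) \<le> exp 8 * exp (\<Lambda>\<^sup>2 / 2 * (real n + 1))"
      by (simp flip: exp_add)
  qed (use s in simp_all)
  finally show ?thesis unfolding f_def s_def by (simp add: field_simps)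
qed

section \<open>Poisson mixtures of the ballot arrays\<close>

definition poisson_weight :: "real \<Rightarrow> nat \<Rightarrow> real" where
  "poisson_weight t n = exp (- 2 * t) * ((2 * t) ^ n / fact n)"

definition heat_coeff :: "real \<Rightarrow> nat \<times> nat \<Rightarrow> real" where
  "heat_coeff t p = (\<Sum>n. poisson_weight t n * ballot2 n p)"

text \<open>The bracket ending in nested exponentials comes from \<open>poisson_moment\<close>, the
  factors before it from \<open>array_sum_le\<close> with
  \<open>\<Lambda> = \<epsilon> / sqrt t \<le> \<epsilon>\<close>.\<close>

definition heat_const :: "real \<Rightarrow> real" where
  "heat_const \<epsilon> = 64 * (1 + exp (\<epsilon> + 4)) * exp 8 * (2 * exp (\<epsilon>\<^sup>2 / 2) * exp (\<epsilon>\<^sup>2 * exp (\<epsilon>\<^sup>2 / 2)))"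

lemma heat_const_pos: "heat_const \<epsilon> > 0"
  unfolding heat_const_def by (intro mult_pos_pos add_pos_pos) simp_all

lemma poisson_weight_nonneg [simp]: "t \<ge> 0 \<Longrightarrow> poisson_weight t n \<ge> 0"
  by (simp add: poisson_weight_def)

lemma exp_sums: "(\<lambda>n. x ^ n / fact n) sums exp (x :: real)"
  using exp_converges[of x] by (simp add: field_simps)

lemma poisson_weight_sums: "poisson_weight t sums 1"
  using sums_mult[OF exp_sums[of "2 * t"], of "exp (- 2 * t)"]
  unfolding poisson_weight_def by (simp flip: exp_add)

lemma ballot2_nonneg [simp]: "ballot2 n p \<ge> 0"
  by (cases p) (simp add: ballot2_def)

lemma lazy_walk_le_1: "lazy_walk N r \<le> 1"
proof -
  have "2 * N choose (N + r) \<le> 2 ^ (2 * N)" by (rule binomial_le_pow2)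
  then have "real (2 * N choose (N + r)) \<le> 4 ^ N"
    by (metis of_nat_le_iff of_nat_numeral of_nat_power power_mult power2_eq_square num_double numeral_times_numeral)
  then show ?thesis by (simp add: lazy_walk_def)
qed

lemma ballot2_le_1: "ballot2 n p \<le> 1"
proof -
  have "ballot n m \<le> 1" for m
    using lazy_walk_le_1[of n m] lazy_walk_nonneg[of n "m + 2"] unfolding ballot_def by linarith
  then show ?thesis by (cases p) (simp add: ballot2_def)
qed

lemma heat_coeff_sums:
  assumes "t \<ge> 0"
  shows "(\<lambda>n. poisson_weight t n * ballot2 n p) sums heat_coeff t p"
  unfolding heat_coeff_def
proof (rule summable_sums, rule summable_comparison_test')
  show "summable (poisson_weight t)" using poisson_weight_sums by (rule sums_summable)
  show "norm (poisson_weight t n * ballot2 n p) \<le> poisson_weight t n" for n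
    using assms ballot2_le_1[of n p] by (simp add: mult_left_le)
qed

text \<open>Differences pass through the series, so those of \<open>heat_coeff\<close> are mixtures
  of differences of ballot arrays.\<close>

lemma sums_diff_fst:
  assumes "\<And>p. (\<lambda>n. f n p) sums c p"
  shows "(\<lambda>n. diff_fst (f n) p) sums diff_fst c p"
proof (cases p)
  case (Pair a b)
  show ?thesis unfolding Pair diff_fst_def
    by (cases a) (auto intro!: sums_diff assms)
qed

lemma sums_diff_snd:
  assumes "\<And>p. (\<lambda>n. f n p) sums c p"
  shows "(\<lambda>n. diff_snd (f n) p) sums diff_snd c p"
proof (cases p)
  case (Pair a b)
  show ?thesis unfolding Pair diff_snd_def
    by (cases b) (auto intro!: sums_diff assms)
qed

lemma diff_fst_cmult: "diff_fst (\<lambda>p. k * c p) = (\<lambda>p. k * diff_fst c p)"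
  by (auto simp: diff_fst_def right_diff_distrib split: nat.split)

lemma diff_snd_cmult: "diff_snd (\<lambda>p. k * c p) = (\<lambda>p. k * diff_snd c p)"
  by (auto simp: diff_snd_def right_diff_distrib split: nat.split)

text \<open>For a Poisson variable of mean \<open>2 * t\<close>, negative powers of
  \<open>n + 1\<close> average to negative powers of \<open>t\<close>, and an exponential tilt of
  rate \<open>\<epsilon>^2 / (2 * t)\<close> costs a bounded factor when
  \<open>t \<ge> 1\<close>.\<close>

lemma poisson_moment:
  fixes \<epsilon> t :: real
  assumes t: "t \<ge> 1" and j: "j \<le> 2"
  defines "u \<equiv> \<lambda>n. poisson_weight t n * (exp ((\<epsilon> / sqrt t)\<^sup>2 / 2 * (real n + 1)) / sqrt (real n + 1) ^ j)"
  shows "summable u"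
    and "suminf u \<le> 2 * exp (\<epsilon>\<^sup>2 / 2) * exp (\<epsilon>\<^sup>2 * exp (\<epsilon>\<^sup>2 / 2)) / sqrt t ^ j"
proof -
  define x where "x = \<epsilon>\<^sup>2 / (2 * t)"
  define z where "z = exp x"
  have x: "x \<ge> 0" "x \<le> \<epsilon>\<^sup>2 / 2" "2 * t * x = \<epsilon>\<^sup>2"
    using t mult_right_mono[of 1 t "\<epsilon>\<^sup>2"] by (auto simp: x_def field_simps)
  have z: "z \<ge> 1" "z \<le> exp (\<epsilon>\<^sup>2 / 2)" using x by (auto simp: z_def)
  \<comment> \<open>The majorant is a combination of exponential series: in its second part the
    denominator \<open>n + 1\<close> turns \<open>fact n\<close> into
    \<open>fact (n + 1)\<close>.\<close>
  define v where "v = (\<lambda>n. exp (- 2 * t) / sqrt t ^ j *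
      (z * ((2 * t * z) ^ n / fact n) + ((2 * t * z) ^ Suc n / fact (Suc n)) / 2))"
  define S where "S = exp (- 2 * t) / sqrt t ^ j * (z * exp (2 * t * z) + (exp (2 * t * z) - 1) / 2)"
  have v: "v sums S"
    unfolding v_def S_def
    by (intro sums_mult sums_add sums_divide exp_sums)
      (use exp_sums[of "2 * t * z"] in \<open>subst sums_Suc_iff, simp\<close>)
  have uv: "0 \<le> u n" "u n \<le> v n" for n
  proof -
    show "0 \<le> u n" using t by (simp add: u_def)
    \<comment> \<open>Since \<open>y ^ j \<le> 1 + y^2\<close> for \<open>j \<le> 2\<close>, the
      square roots give way to the rational factor \<open>1 + t / (n + 1)\<close>.\<close>
    define y where "y = sqrt t / sqrt (real n + 1)"
    have y: "y \<ge> 0" "y\<^sup>2 = t / (real n + 1)" using t by (auto simp: y_def power_divide)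
    have "j = 0 \<or> j = 1 \<or> j = 2" using j by auto
    moreover have "y \<le> 1 + y\<^sup>2" using zero_le_power2[of "y - 1"] y(1) unfolding power2_diff by simp
    ultimately have "y ^ j \<le> 1 + t / (real n + 1)" unfolding y(2)[symmetric] by auto
    then have "y ^ j / sqrt t ^ j \<le> (1 + t / (real n + 1)) / sqrt t ^ j"
      using t by (intro divide_right_mono) auto
    then have le: "1 / sqrt (real n + 1) ^ j \<le> (1 + t / (real n + 1)) / sqrt t ^ j"
      using t by (simp add: y_def power_divide)
    have eq: "exp ((\<epsilon> / sqrt t)\<^sup>2 / 2 * (real n + 1)) = z ^ Suc n"
    proof -
      have "z ^ Suc n = exp (real (Suc n) * x)" unfolding z_def by (rule exp_of_nat_mult[symmetric])
      moreover have "(\<epsilon> / sqrt t)\<^sup>2 / 2 * (real n + 1) = real (Suc n) * x"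
        using t by (simp add: x_def power_divide mult_ac add_ac)
      ultimately show ?thesis by simp
    qed
    have "u n = poisson_weight t n * (z ^ Suc n * (1 / sqrt (real n + 1) ^ j))"
      unfolding u_def eq by simp
    also have "\<dots> \<le> poisson_weight t n * (z ^ Suc n * ((1 + t / (real n + 1)) / sqrt t ^ j))"
      using t z by (intro mult_left_mono le) auto
    also have "\<dots> = exp (- 2 * t) / sqrt t ^ j * ((2 * t) ^ n / fact n * (z ^ Suc n * (1 + t / (real n + 1))))"
      by (simp add: poisson_weight_def mult_ac)
    also have "(2 * t) ^ n / fact n * (z ^ Suc n * (1 + t / (real n + 1))) =
        z * ((2 * t * z) ^ n / fact n) + ((2 * t * z) ^ Suc n / fact (Suc n)) / 2"
    proof -
      have "P / f * (z * Q * (1 + t / m)) = z * (P * Q / f) + (2 * t * z * (P * Q) / (m * f)) / 2"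
        if "f \<noteq> 0" "m \<noteq> 0" for P Q f m :: real
        using that by (simp add: field_simps)
      from this[of "fact n" "real n + 1" "(2 * t) ^ n" "z ^ n"] show ?thesis
        by (simp add: power_mult_distrib[of "2 * t" z] add.commute[of "real n" 1] del: power_mult_distrib)
    qed
    finally show "u n \<le> v n" by (simp add: v_def)
  qed
  show su: "summable u"
    by (rule summable_comparison_test'[OF sums_summable[OF v], of 0]) (use uv in auto)
  have "suminf u \<le> S"
    using suminf_le[OF uv(2) su sums_summable[OF v]] sums_unique[OF v] by simp
  also have "\<dots> \<le> exp (- 2 * t) / sqrt t ^ j * (2 * z * exp (2 * t * z))"
    unfolding S_def
  proof (intro mult_left_mono)
    have "(e - 1) / 2 \<le> z * e" if "e > 0" for e :: real
    proof -
      have "(e - 1) / 2 \<le> 1 * e" using that by simp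
      also have "\<dots> \<le> z * e" using z that by (intro mult_right_mono) auto
      finally show ?thesis .
    qed
    then have "(exp (2 * t * z) - 1) / 2 \<le> z * exp (2 * t * z)" by simp
    then show "z * exp (2 * t * z) + (exp (2 * t * z) - 1) / 2 \<le> 2 * z * exp (2 * t * z)" by simp
  qed (use t in auto)
  also have "\<dots> = 2 * z * exp (2 * t * (z - 1)) / sqrt t ^ j"
    by (simp add: right_diff_distrib exp_diff exp_minus field_simps)
  also have "\<dots> \<le> 2 * exp (\<epsilon>\<^sup>2 / 2) * exp (\<epsilon>\<^sup>2 * exp (\<epsilon>\<^sup>2 / 2)) / sqrt t ^ j"
  proof -
    \<comment> \<open>In the form \<open>z - 1 \<le> x * z\<close> this bounds the exponent
      \<open>2 * t * (z - 1)\<close> by \<open>\<epsilon>^2 * z\<close>, because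
      \<open>2 * t * x = \<epsilon>^2\<close>.\<close>
    have "1 - x \<le> exp (- x)" using exp_ge_add_one_self[of "- x"] by simp
    then have "exp x * (1 - x) \<le> exp x * exp (- x)" by (intro mult_left_mono) auto
    then have "z - 1 \<le> x * z" unfolding z_def by (simp add: exp_minus algebra_simps)
    then have "2 * t * (z - 1) \<le> 2 * t * (x * z)" using t by (intro mult_left_mono) auto
    also have "\<dots> = \<epsilon>\<^sup>2 * z" unfolding x(3)[symmetric] by simp
    also have "\<dots> \<le> \<epsilon>\<^sup>2 * exp (\<epsilon>\<^sup>2 / 2)" using z by (intro mult_left_mono) auto
    finally show ?thesis using z t by (intro divide_right_mono mult_mono) auto
  qed
  finally show "suminf u \<le> 2 * exp (\<epsilon>\<^sup>2 / 2) * exp (\<epsilon>\<^sup>2 * exp (\<epsilon>\<^sup>2 / 2)) / sqrt t ^ j" .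
qed

text \<open>The triangle inequality inside the Poisson series. As \<open>F\<close> is finite, sum
  and series may be exchanged, after which \<open>array_sum_le\<close> bounds the sum for each
  \<open>n\<close>.\<close>

lemma poisson_mixture_le:
  fixes g :: "nat \<Rightarrow> nat \<times> nat \<Rightarrow> real"
  assumes t: "t \<ge> 1" and j: "j \<le> 2" and \<epsilon>: "\<epsilon> \<ge> 0"
    and sums: "\<And>p. (\<lambda>n. poisson_weight t n * g n p) sums c p"
    and rows: "\<And>n k. (\<Sum>i\<le>k. \<bar>g n (i, k - i)\<bar>) \<le>
      64 * exp (real k / sqrt (real n + 1)) ^ 4 * lazy_walk (Suc n) (k - 1) / sqrt (real n + 1) ^ j"
    and F: "finite F"
  shows "(\<Sum>(a, b)\<in>F. \<bar>c (a, b)\<bar> * exp (\<epsilon> / sqrt t * (real a + real b))) \<le> heat_const \<epsilon> / sqrt t ^ j"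
proof -
  define w where "w = (\<lambda>(a, b). exp (\<epsilon> / sqrt t * (real a + real b)))"
  have w: "w p > 0" for p by (cases p) (simp add: w_def)
  define A where "A = 64 * (1 + exp (\<epsilon> + 4)) * exp 8"
  define u where "u = (\<lambda>n. poisson_weight t n * (exp ((\<epsilon> / sqrt t)\<^sup>2 / 2 * (real n + 1)) / sqrt (real n + 1) ^ j))"
  have u: "summable u" "suminf u \<le> 2 * exp (\<epsilon>\<^sup>2 / 2) * exp (\<epsilon>\<^sup>2 * exp (\<epsilon>\<^sup>2 / 2)) / sqrt t ^ j"
    unfolding u_def using poisson_moment[OF t j] by auto
  have t0: "t \<ge> 0" "\<epsilon> / sqrt t \<ge> 0" using t \<epsilon> by auto
  have "\<epsilon> / sqrt t \<le> \<epsilon>" using t \<epsilon> by (simp add: divide_le_eq mult_le_cancel_left1)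
  have gF: "(\<Sum>p\<in>F. poisson_weight t n * \<bar>g n p\<bar> * w p) \<le> A * u n" for n
  proof -
    have "(\<Sum>p\<in>F. \<bar>g n p\<bar> * w p) \<le> 64 * (1 + exp (\<epsilon> / sqrt t + 4)) * exp 8 *
        exp ((\<epsilon> / sqrt t)\<^sup>2 / 2 * (real n + 1)) / sqrt (real n + 1) ^ j"
      using array_sum_le[OF rows t0(2) F, of n] by (simp add: w_def case_prod_unfold)
    also have "\<dots> \<le> A * exp ((\<epsilon> / sqrt t)\<^sup>2 / 2 * (real n + 1)) / sqrt (real n + 1) ^ j"
      unfolding A_def using \<open>\<epsilon> / sqrt t \<le> \<epsilon>\<close> by (intro divide_right_mono mult_right_mono) auto
    finally have "poisson_weight t n * (\<Sum>p\<in>F. \<bar>g n p\<bar> * w p) \<le>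
        poisson_weight t n * (A * exp ((\<epsilon> / sqrt t)\<^sup>2 / 2 * (real n + 1)) / sqrt (real n + 1) ^ j)"
      using t0 by (intro mult_left_mono) auto
    then show ?thesis by (simp add: u_def sum_distrib_left mult_ac)
  qed
  have sm: "summable (\<lambda>n. poisson_weight t n * \<bar>g n p\<bar> * w p)" if "p \<in> F" for p
  proof (rule summable_comparison_test'[of "\<lambda>n. A * u n" 0])
    show "summable (\<lambda>n. A * u n)" using u(1) by (rule summable_mult)
    show "norm (poisson_weight t n * \<bar>g n p\<bar> * w p) \<le> A * u n" for n
      using gF[of n] member_le_sum[OF that, of "\<lambda>p. poisson_weight t n * \<bar>g n p\<bar> * w p"] F t0 w
      by (simp add: less_imp_le)
  qed
  have cp: "\<bar>c p\<bar> * w p \<le> (\<Sum>n. poisson_weight t n * \<bar>g n p\<bar> * w p)" if "p \<in> F" for p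
  proof -
    have "c p * w p = (\<Sum>n. poisson_weight t n * g n p * w p)"
      by (rule sums_unique[OF sums_mult2[OF sums]])
    moreover have norm: "norm (poisson_weight t n * g n p * w p) = poisson_weight t n * \<bar>g n p\<bar> * w p" for n
      using t0(1) w[of p] by (simp add: abs_mult)
    ultimately have "norm (c p * w p) \<le> (\<Sum>n. poisson_weight t n * \<bar>g n p\<bar> * w p)"
      using summable_norm[of "\<lambda>n. poisson_weight t n * g n p * w p"] sm[OF that]
      unfolding norm by simp
    then show ?thesis using w[of p] by (simp add: abs_mult)
  qed
  have "(\<Sum>p\<in>F. \<bar>c p\<bar> * w p) \<le> (\<Sum>p\<in>F. \<Sum>n. poisson_weight t n * \<bar>g n p\<bar> * w p)"
    by (intro sum_mono cp)
  also have "\<dots> = (\<Sum>n. \<Sum>p\<in>F. poisson_weight t n * \<bar>g n p\<bar> * w p)"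
    by (rule suminf_sum[symmetric]) (rule sm)
  also have "\<dots> \<le> (\<Sum>n. A * u n)"
    using gF sm u(1) by (intro suminf_le summable_sum summable_mult) auto
  also have "\<dots> = A * suminf u" using u(1) by (rule suminf_mult)
  also have "\<dots> \<le> A * (2 * exp (\<epsilon>\<^sup>2 / 2) * exp (\<epsilon>\<^sup>2 * exp (\<epsilon>\<^sup>2 / 2)) / sqrt t ^ j)"
    using u(2) by (intro mult_left_mono) (auto simp: A_def add_nonneg_nonneg)
  also have "\<dots> = heat_const \<epsilon> / sqrt t ^ j" by (simp add: heat_const_def A_def)
  finally show ?thesis by (simp add: w_def case_prod_unfold)
qed

lemma heat_coeff_bounds:
  fixes \<epsilon> t :: real
  assumes "t \<ge> 1" "\<epsilon> \<ge> 0" "finite F"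
  defines "W \<equiv> \<lambda>c :: nat \<times> nat \<Rightarrow> real. (\<Sum>(a, b)\<in>F. \<bar>c (a, b)\<bar> * exp (\<epsilon> / sqrt t * (real a + real b)))"
  shows "W (heat_coeff t) \<le> heat_const \<epsilon>"
    and "W (diff_fst (heat_coeff t)) \<le> heat_const \<epsilon> / sqrt t"
    and "W (diff_snd (heat_coeff t)) \<le> heat_const \<epsilon> / sqrt t"
    and "W (diff_snd (diff_fst (heat_coeff t))) \<le> heat_const \<epsilon> / t"
proof -
  have t: "t \<ge> 0" using assms by simp
  note s = heat_coeff_sums[OF t]
  show "W (heat_coeff t) \<le> heat_const \<epsilon>"
    unfolding W_def using poisson_mixture_le[OF assms(1) _ assms(2) s row_ballot2 assms(3)] by simp
  show "W (diff_fst (heat_coeff t)) \<le> heat_const \<epsilon> / sqrt t"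
    unfolding W_def
    using poisson_mixture_le[OF assms(1) _ assms(2) sums_diff_fst[OF s, unfolded diff_fst_cmult] row_diff_fst assms(3)]
    by simp
  show "W (diff_snd (heat_coeff t)) \<le> heat_const \<epsilon> / sqrt t"
    unfolding W_def
    using poisson_mixture_le[OF assms(1) _ assms(2) sums_diff_snd[OF s, unfolded diff_snd_cmult] row_diff_snd assms(3)]
    by simp
  show "W (diff_snd (diff_fst (heat_coeff t))) \<le> heat_const \<epsilon> / t"
    unfolding W_def
    using poisson_mixture_le[OF assms(1) _ assms(2)
        sums_diff_snd[OF sums_diff_fst[OF s], unfolded diff_fst_cmult diff_snd_cmult]
        row_diff_snd_diff_fst assms(3)] t
    by simp
qed

section \<open>Kernels on the tree\<close>

text \<open>The shifted family is supported on the range of an injection. It is the series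
  subtracted when a gradient acts on coefficients.\<close>

lemma has_sum_shift_fst:
  fixes f :: "nat \<times> nat \<Rightarrow> real"
  assumes "(f has_sum S) UNIV"
  shows "((\<lambda>(a, b). case a of 0 \<Rightarrow> 0 | Suc a' \<Rightarrow> f (a', b)) has_sum S) UNIV"
proof -
  define h :: "nat \<times> nat \<Rightarrow> nat \<times> nat" where "h = (\<lambda>(a, b). (Suc a, b))"
  define g where "g = (\<lambda>(a, b). case a of 0 \<Rightarrow> 0 | Suc a' \<Rightarrow> f (a', b))"
  have "inj h" by (auto simp: h_def inj_def)
  moreover have "g \<circ> h = f" by (auto simp: g_def h_def fun_eq_iff)
  ultimately have "(g has_sum S) (range h)" using assms by (simp add: has_sum_reindex)
  then have "(g has_sum S) UNIV"
    by (rule has_sum_cong_neutral[THEN iffD1, rotated -1])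
      (auto simp: g_def h_def image_iff split: nat.split)
  then show ?thesis unfolding g_def .
qed

lemma has_sum_swap_pair:
  fixes f :: "nat \<times> nat \<Rightarrow> real"
  assumes "(f has_sum S) UNIV"
  shows "((\<lambda>(a, b). f (b, a)) has_sum S) UNIV"
proof -
  have "((\<lambda>p. f (prod.swap p)) has_sum S) UNIV"
    using assms by (subst has_sum_reindex_bij_betw[OF bij_swap]) 
  then show ?thesis by (simp add: case_prod_unfold prod.swap_def)
qed

lemma has_sum_shift_snd:
  fixes f :: "nat \<times> nat \<Rightarrow> real"
  assumes "(f has_sum S) UNIV"
  shows "((\<lambda>(a, b). case b of 0 \<Rightarrow> 0 | Suc b' \<Rightarrow> f (a, b')) has_sum S) UNIV"
  using has_sum_swap_pair[OF has_sum_shift_fst[OF has_sum_swap_pair[OF assms]]]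
  by (rule has_sum_cong[THEN iffD1, rotated]) (auto split: nat.split)

lemma has_sum_diff_real:
  fixes f g :: "'b \<Rightarrow> real"
  assumes "(f has_sum a) A" "(g has_sum b) A"
  shows "((\<lambda>x. f x - g x) has_sum (a - b)) A"
  using has_sum_add[OF assms(1) has_sum_uminusI[OF assms(2)]] by simp

lemma has_sum_finite_sum:
  fixes f :: "'i \<Rightarrow> 'b \<Rightarrow> 'c::topological_comm_monoid_add"
  assumes "\<And>i. i \<in> I \<Longrightarrow> (f i has_sum s i) A"
  shows "((\<lambda>x. \<Sum>i\<in>I. f i x) has_sum (\<Sum>i\<in>I. s i)) A"
  using assms by (induction I rule: infinite_finite_induct) (auto intro: has_sum_add)

lemma summable_on_abs_real_iff:
  fixes f :: "'b \<Rightarrow> real"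
  shows "(\<lambda>x. \<bar>f x\<bar>) summable_on A \<longleftrightarrow> f summable_on A"
  using summable_on_iff_abs_summable_on_real[of f A] by simp

section \<open>The kernels of \<open>U^a D^b\<close> and of series in them\<close>

context flow_tree begin

lemma q_pos: "real q > 0"
  using q_ge_2 by simp

lemma flow_measure_pos [simp]: "flow_measure x > 0"
  unfolding flow_measure_def using q_pos by simp

lemma flow_measure_nonneg [simp]: "flow_measure x \<ge> 0"
  using flow_measure_pos less_imp_le by blast

lemma flow_measure_neq_0 [simp]: "flow_measure x \<noteq> 0"
  using flow_measure_pos less_imp_neq by metis

lemma flow_measure_funpow: "flow_measure ((predecessor ^^ a) x) = real q ^ a * flow_measure x"
  unfolding flow_measure_def using q_pos by (simp add: power_int_add)

lemma flow_measure_predecessor: "flow_measure (predecessor x) = real q * flow_measure x"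
  using flow_measure_funpow[of 1 x] by simp

text \<open>
  The kernel, with respect to the flow measure, of the operator \<open>U^a D^b\<close>.
\<close>

definition climb :: "nat \<Rightarrow> nat \<Rightarrow> 'a \<Rightarrow> 'a \<Rightarrow> real" where
  "climb a b x y = (if (predecessor ^^ a) x = (predecessor ^^ b) y
     then 1 / flow_measure ((predecessor ^^ a) x) else 0)"

lemma climb_nonneg [simp]: "climb a b x y \<ge> 0"
  by (simp add: climb_def)

text \<open>The measure does not decrease along ancestors. Uniformity in \<open>a\<close> and
  \<open>b\<close> makes a kernel with summable coefficients converge absolutely.\<close>

lemma climb_le: "climb a b x y \<le> 1 / flow_measure x"
proof -
  have "real q ^ a \<ge> 1" using q_ge_2 by (intro one_le_power) simp
  then have "flow_measure x \<le> flow_measure ((predecessor ^^ a) x)"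
    using mult_right_mono[of 1 "real q ^ a" "flow_measure x"] unfolding flow_measure_funpow by simp
  then have "1 / flow_measure ((predecessor ^^ a) x) \<le> 1 / flow_measure x"
    by (intro frac_le) auto
  moreover have "0 \<le> 1 / flow_measure x" by simp
  ultimately show ?thesis unfolding climb_def by (simp only: split: if_split) blast
qed

lemma climb_sym: "climb a b x y = climb b a y x"
  by (simp add: climb_def)

text \<open>Moving \<open>x\<close> up is one more step \<open>U\<close>; hence the gradient acts as
  a difference in \<open>a\<close>.\<close>

lemma climb_predecessor_fst: "climb a b (predecessor x) y = climb (Suc a) b x y"
  by (simp add: climb_def funpow_swap1)

lemma climb_predecessor_snd: "climb a b x (predecessor y) = climb a (Suc b) x y"
  by (simp add: climb_def funpow_swap1)

text \<open>This is \<open>D U = I\<close>: all children of \<open>x\<close> have the same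
  predecessor.\<close>

lemma climb_children_Suc: "(\<Sum>z\<in>children x. climb (Suc a) b z y) = real q * climb a b x y"
proof -
  have "(\<Sum>z\<in>children x. climb (Suc a) b z y) = (\<Sum>z\<in>children x. climb a b x y)"
    by (intro sum.cong refl) (auto simp: children_def climb_predecessor_fst[symmetric])
  then show ?thesis by (simp add: card_children)
qed

text \<open>With no step up to cancel, averaging adds a step down. At most one child of
  \<open>x\<close> is the \<open>b\<close>-th ancestor of \<open>y\<close>, and \<open>q\<close>
  compensates for the larger measure of \<open>x\<close>.\<close>

lemma climb_children_0: "(\<Sum>z\<in>children x. climb 0 b z y) = real q * climb 0 (Suc b) x y"
proof -
  define u where "u = (predecessor ^^ b) y"
  have "(\<Sum>z\<in>children x. climb 0 b z y) = (\<Sum>z\<in>children x. if z = u then 1 / flow_measure u else 0)"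
    by (intro sum.cong refl) (auto simp: climb_def u_def)
  also have "\<dots> = (if predecessor u = x then 1 / flow_measure u else 0)"
    unfolding sum.delta[OF finite_children] by (simp add: children_def)
  also have "\<dots> = real q * climb 0 (Suc b) x y"
    using q_pos by (auto simp: climb_def u_def flow_measure_predecessor)
  finally show ?thesis .
qed

text \<open>The support consists of the \<open>q ^ a\<close> vertices that lie \<open>a\<close>
  generations below the \<open>b\<close>-th ancestor of \<open>y\<close>, each of weight
  \<open>1 / q ^ a\<close>.\<close>

lemma climb_mass:
  assumes "finite F"
  shows "(\<Sum>x\<in>F. climb a b x y * flow_measure x) \<le> 1"
proof -
  define D where "D = {x. (predecessor ^^ a) x = (predecessor ^^ b) y}"
  have D: "finite D" "card D = q ^ a" using card_descendants unfolding D_def by auto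
  have "(\<Sum>x\<in>F. climb a b x y * flow_measure x) = (\<Sum>x\<in>F \<inter> D. climb a b x y * flow_measure x)"
    using assms by (intro sum.mono_neutral_right) (auto simp: D_def climb_def)
  also have "\<dots> \<le> (\<Sum>x\<in>D. climb a b x y * flow_measure x)"
    using D by (intro sum_mono2) auto
  also have "\<dots> = (\<Sum>x\<in>D. 1 / real q ^ a)"
  proof (intro sum.cong refl)
    fix x assume "x \<in> D"
    then have "climb a b x y = 1 / (real q ^ a * flow_measure x)"
      unfolding flow_measure_funpow[symmetric] by (simp add: climb_def D_def)
    then show "climb a b x y * flow_measure x = 1 / real q ^ a" by simp
  qed
  also have "\<dots> = 1" using D q_pos by simp
  finally show ?thesis .
qed

definition kernel :: "(nat \<times> nat \<Rightarrow> real) \<Rightarrow> 'a \<Rightarrow> 'a \<Rightarrow> real" where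
  "kernel c x y = (\<Sum>\<^sub>\<infinity>(a, b). c (a, b) * climb a b x y)"

lemma kernel_abs_summable:
  assumes "c summable_on UNIV"
  shows "(\<lambda>(a, b). \<bar>c (a, b)\<bar> * climb a b x y) summable_on UNIV"
proof (rule summable_on_comparison_test)
  show "(\<lambda>p. \<bar>c p\<bar> * (1 / flow_measure x)) summable_on UNIV"
    using assms by (intro summable_on_cmult_left) (simp only: summable_on_abs_real_iff)
  show "(case p of (a, b) \<Rightarrow> \<bar>c (a, b)\<bar> * climb a b x y) \<le> \<bar>c p\<bar> * (1 / flow_measure x)" for p
    using mult_left_mono[OF climb_le, of "\<bar>c p\<bar>" "fst p" "snd p" x y] by (cases p) simp
qed auto

lemma kernel_has_sum:
  assumes "c summable_on UNIV"
  shows "((\<lambda>(a, b). c (a, b) * climb a b x y) has_sum kernel c x y) UNIV"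
proof -
  have "(\<lambda>(a, b). c (a, b) * climb a b x y) summable_on UNIV"
    using kernel_abs_summable[OF assms, of x y]
    by (subst summable_on_abs_real_iff[symmetric]) (simp add: case_prod_unfold abs_mult)
  then show ?thesis unfolding kernel_def by (rule has_sum_infsum)
qed

lemma kernel_eqI:
  "((\<lambda>(a, b). c (a, b) * climb a b x y) has_sum s) UNIV \<Longrightarrow> kernel c x y = s"
  unfolding kernel_def by (rule infsumI)

lemma abs_kernel_le:
  assumes "c summable_on UNIV"
  shows "\<bar>kernel c x y\<bar> \<le> (\<Sum>\<^sub>\<infinity>(a, b). \<bar>c (a, b)\<bar> * climb a b x y)"
  using norm_infsum_bound[of "\<lambda>(a, b). c (a, b) * climb a b x y" UNIV] kernel_abs_summable[OF assms, of x y]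
  unfolding kernel_def by (simp add: case_prod_unfold abs_mult)

text \<open>Each \<open>U^a D^b\<close> lives on pairs at distance at most \<open>a + b\<close> and
  has mass at most 1. Exchanging the sum over \<open>x\<close> with the series therefore leaves the
  weighted l1 norm of \<open>c\<close>, and \<open>q\<close> drops out.\<close>

lemma kernel_weighted_sum_le:
  assumes \<Lambda>: "\<Lambda> \<ge> 0" and F: "finite F"
    and M: "\<And>G. finite G \<Longrightarrow> (\<Sum>(a, b)\<in>G. \<bar>c (a, b)\<bar> * exp (\<Lambda> * (real a + real b))) \<le> M"
  shows "(\<Sum>x\<in>F. \<bar>kernel c x y\<bar> * exp (\<Lambda> * real (gdist x y)) * flow_measure x) \<le> M"
proof -
  define W where "W = (\<lambda>(a, b). \<bar>c (a, b)\<bar> * exp (\<Lambda> * (real a + real b)))"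
  have W: "W summable_on UNIV"
    by (rule nonneg_bdd_above_summable_on)
      (use M in \<open>auto simp: W_def bdd_above_def case_prod_unfold\<close>)
  have "(\<lambda>p. \<bar>c p\<bar>) summable_on UNIV"
  proof (rule summable_on_comparison_test[OF W])
    show "\<bar>c p\<bar> \<le> W p" for p using \<Lambda> by (cases p) (simp add: W_def mult_le_cancel_left1)
  qed auto
  then have c: "c summable_on UNIV" by (simp only: summable_on_abs_real_iff)
  define k where "k = (\<lambda>x p. W p * (climb (fst p) (snd p) x y * flow_measure x))"
  have k: "k x summable_on UNIV" for x
  proof (rule summable_on_comparison_test[OF W])
    show "k x p \<le> W p" for p
      using climb_mass[of "{x}" "fst p" "snd p" y] unfolding k_def
      by (intro mult_left_le) (auto simp: W_def case_prod_unfold)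
  qed (auto simp: k_def W_def case_prod_unfold)
  have "(\<Sum>x\<in>F. \<bar>kernel c x y\<bar> * exp (\<Lambda> * real (gdist x y)) * flow_measure x) \<le> (\<Sum>x\<in>F. infsum (k x) UNIV)"
  proof (rule sum_mono)
    fix x
    define r where "r = exp (\<Lambda> * real (gdist x y)) * flow_measure x"
    have "\<bar>kernel c x y\<bar> * r \<le> (\<Sum>\<^sub>\<infinity>(a, b). \<bar>c (a, b)\<bar> * climb a b x y) * r"
      by (rule mult_right_mono[OF abs_kernel_le[OF c]]) (simp add: r_def)
    also have "\<dots> = (\<Sum>\<^sub>\<infinity>p. (case p of (a, b) \<Rightarrow> \<bar>c (a, b)\<bar> * climb a b x y) * r)"
      by (rule infsum_cmult_left'[symmetric])
    also have "\<dots> \<le> infsum (k x) UNIV"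
    proof (rule infsum_mono)
      show "(\<lambda>p. (case p of (a, b) \<Rightarrow> \<bar>c (a, b)\<bar> * climb a b x y) * r) summable_on UNIV"
        by (rule summable_on_cmult_left[OF kernel_abs_summable[OF c]])
      show "(case p of (a, b) \<Rightarrow> \<bar>c (a, b)\<bar> * climb a b x y) * r \<le> k x p" for p
      proof (cases p)
        case (Pair a b)
        show ?thesis
        proof (cases "(predecessor ^^ a) x = (predecessor ^^ b) y")
          case True
          have "real (gdist x y) \<le> real a + real b" using gdist_le_if_funpow_eq[OF True] by simp
          then have "exp (\<Lambda> * real (gdist x y)) \<le> exp (\<Lambda> * (real a + real b))"
            using \<Lambda> by (simp add: mult_left_mono)
          then have "\<bar>c (a, b)\<bar> * climb a b x y * flow_measure x * exp (\<Lambda> * real (gdist x y)) \<le>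
              \<bar>c (a, b)\<bar> * climb a b x y * flow_measure x * exp (\<Lambda> * (real a + real b))"
            by (intro mult_left_mono) auto
          then show ?thesis by (simp add: Pair k_def W_def r_def mult_ac)
        qed (simp add: Pair k_def climb_def)
      qed
    qed (rule k)
    finally show "\<bar>kernel c x y\<bar> * exp (\<Lambda> * real (gdist x y)) * flow_measure x \<le> infsum (k x) UNIV"
      by (simp add: r_def mult_ac)
  qed
  also have "\<dots> = (\<Sum>\<^sub>\<infinity>p. \<Sum>x\<in>F. k x p)"
    using infsumI[OF has_sum_finite_sum[OF has_sum_infsum[OF k], where I = F]] by simp
  also have "\<dots> \<le> infsum W UNIV"
  proof (rule infsum_mono)
    show "(\<lambda>p. \<Sum>x\<in>F. k x p) summable_on UNIV"
      by (rule has_sum_imp_summable[OF has_sum_finite_sum[OF has_sum_infsum[OF k]]])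
    show "(\<Sum>x\<in>F. k x p) \<le> W p" for p
      using climb_mass[OF F, of "fst p" "snd p" y] unfolding k_def sum_distrib_left[symmetric]
      by (intro mult_left_le) (auto simp: W_def case_prod_unfold)
  qed (rule W)
  also have "\<dots> \<le> M"
    by (rule infsum_le_finite_sums[OF W]) (use M in \<open>auto simp: W_def\<close>)
  finally show ?thesis .
qed

lemma kernel_diff_fst:
  assumes "c summable_on UNIV"
  shows "kernel (diff_fst c) x y = kernel c x y - kernel c (predecessor x) y"
proof (rule kernel_eqI)
  have "((\<lambda>(a, b). c (a, b) * climb (Suc a) b x y) has_sum kernel c (predecessor x) y) UNIV"
    using kernel_has_sum[OF assms, of "predecessor x" y] by (simp add: climb_predecessor_fst)
  from has_sum_diff_real[OF kernel_has_sum[OF assms, of x y] has_sum_shift_fst[OF this]]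
  show "((\<lambda>(a, b). diff_fst c (a, b) * climb a b x y) has_sum
      (kernel c x y - kernel c (predecessor x) y)) UNIV"
    by (rule has_sum_cong[THEN iffD1, rotated]) (auto simp: diff_fst_def left_diff_distrib split: nat.split)
qed

lemma kernel_diff_snd:
  assumes "c summable_on UNIV"
  shows "kernel (diff_snd c) x y = kernel c x y - kernel c x (predecessor y)"
proof (rule kernel_eqI)
  have "((\<lambda>(a, b). c (a, b) * climb a (Suc b) x y) has_sum kernel c x (predecessor y)) UNIV"
    using kernel_has_sum[OF assms, of x "predecessor y"] by (simp add: climb_predecessor_snd)
  from has_sum_diff_real[OF kernel_has_sum[OF assms, of x y] has_sum_shift_snd[OF this]]
  show "((\<lambda>(a, b). diff_snd c (a, b) * climb a b x y) has_sum
      (kernel c x y - kernel c x (predecessor y))) UNIV"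
    by (rule has_sum_cong[THEN iffD1, rotated]) (auto simp: diff_snd_def left_diff_distrib split: nat.split)
qed

text \<open>
  The coefficients of \<open>D K\<close> when \<open>K\<close> has the coefficients \<open>c\<close>: a step down cancels a step up if
  there is one.
\<close>

definition avg_coeff :: "(nat \<times> nat \<Rightarrow> real) \<Rightarrow> nat \<times> nat \<Rightarrow> real" where
  "avg_coeff c = (\<lambda>(a, b). c (Suc a, b) + (if a = 0 then case b of 0 \<Rightarrow> 0 | Suc b' \<Rightarrow> c (0, b') else 0))"

lemma kernel_children:
  assumes "c summable_on UNIV"
  shows "(\<Sum>z\<in>children x. kernel c z y) / real q = kernel (avg_coeff c) x y"
proof -
  define g where "g = (\<lambda>(a, b). c (a, b) * (case a of 0 \<Rightarrow> climb 0 (Suc b) x y | Suc a' \<Rightarrow> climb a' b x y))"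
  define S where "S = (\<Sum>z\<in>children x. kernel c z y) / real q"
  have "((\<lambda>p. (\<Sum>z\<in>children x. case p of (a, b) \<Rightarrow> c (a, b) * climb a b z y) / real q) has_sum S) UNIV"
    unfolding S_def by (intro has_sum_divide_const has_sum_finite_sum kernel_has_sum assms)
  then have g: "(g has_sum S) UNIV"
    by (rule has_sum_cong[THEN iffD1, rotated])
      (use q_pos in \<open>auto simp: g_def climb_children_Suc climb_children_0 simp flip: sum_distrib_left split: nat.split\<close>)
  \<comment> \<open>Here \<open>h0\<close> indexes the terms without a step up and \<open>h1\<close>
    the others, one step up being cancelled; \<open>h2\<close> is where the terms of
    \<open>h0\<close> land, their \<open>b\<close> raised by one.\<close>
  define h0 :: "nat \<Rightarrow> nat \<times> nat" where "h0 = (\<lambda>b. (0, b))"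
  define h1 :: "nat \<times> nat \<Rightarrow> nat \<times> nat" where "h1 = (\<lambda>(a, b). (Suc a, b))"
  define h2 :: "nat \<Rightarrow> nat \<times> nat" where "h2 = (\<lambda>b. (0, Suc b))"
  have inj: "inj h0" "inj h1" "inj h2" by (auto simp: h0_def h1_def h2_def inj_def)
  have UN: "range h0 \<union> range h1 = UNIV" and disj: "range h0 \<inter> range h1 = {}"
    by (auto simp: h0_def h1_def image_iff) (metis not0_implies_Suc)
  obtain S0 where S0: "(g has_sum S0) (range h0)"
    using summable_on_subset_banach[OF has_sum_imp_summable[OF g], of "range h0"] by (auto simp: summable_on_def)
  obtain S1 where S1: "(g has_sum S1) (range h1)"
    using summable_on_subset_banach[OF has_sum_imp_summable[OF g], of "range h1"] by (auto simp: summable_on_def)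
  have S: "S = S0 + S1"
    using has_sum_Un_disjoint[OF S0 S1 disj] g unfolding UN by (rule has_sum_unique[rotated])
  have 1: "((\<lambda>(a, b). c (Suc a, b) * climb a b x y) has_sum S1) UNIV"
  proof -
    have "(g \<circ> h1 has_sum S1) UNIV" using S1 inj by (simp add: has_sum_reindex)
    moreover have "g \<circ> h1 = (\<lambda>(a, b). c (Suc a, b) * climb a b x y)"
      by (auto simp: g_def h1_def fun_eq_iff)
    ultimately show ?thesis by simp
  qed
  define k where "k = (\<lambda>(a, b). (if a = 0 then case b of 0 \<Rightarrow> 0 | Suc b' \<Rightarrow> c (0, b') else 0) * climb a b x y)"
  have 0: "(k has_sum S0) UNIV"
  proof -
    have "(g \<circ> h0 has_sum S0) UNIV" using S0 inj by (simp add: has_sum_reindex)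
    moreover have "g \<circ> h0 = k \<circ> h2"
      by (auto simp: g_def k_def h0_def h2_def fun_eq_iff)
    ultimately have "(k has_sum S0) (range h2)" using inj by (simp add: has_sum_reindex)
    then show ?thesis
      by (rule has_sum_cong_neutral[THEN iffD1, rotated -1])
        (auto simp: k_def h2_def image_iff split: nat.split)
  qed
  have "kernel (avg_coeff c) x y = S"
  proof (rule kernel_eqI)
    have "((\<lambda>p. (case p of (a, b) \<Rightarrow> c (Suc a, b) * climb a b x y) + k p) has_sum S) UNIV"
      unfolding S add.commute[of S0] by (rule has_sum_add[OF 1 0])
    then show "((\<lambda>(a, b). avg_coeff c (a, b) * climb a b x y) has_sum S) UNIV"
      by (rule has_sum_cong[THEN iffD1, rotated]) (auto simp: avg_coeff_def k_def distrib_right)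
  qed
  then show ?thesis by (simp add: S_def)
qed

end

section \<open>The heat semigroup\<close>

text \<open>Bounding finite sums makes summability part of the bound and matches the form of the
  estimates above.\<close>

definition l1_bound :: "('b \<Rightarrow> real) \<Rightarrow> real \<Rightarrow> bool" where
  "l1_bound c M \<longleftrightarrow> (\<forall>G. finite G \<longrightarrow> (\<Sum>p\<in>G. \<bar>c p\<bar>) \<le> M)"

lemma l1_boundI: "(\<And>G. finite G \<Longrightarrow> (\<Sum>p\<in>G. \<bar>c p\<bar>) \<le> M) \<Longrightarrow> l1_bound c M"
  by (simp add: l1_bound_def)

lemma l1_boundD: "l1_bound c M \<Longrightarrow> finite G \<Longrightarrow> (\<Sum>p\<in>G. \<bar>c p\<bar>) \<le> M"
  by (simp add: l1_bound_def)

lemma l1_bound_nonneg: "l1_bound c M \<Longrightarrow> M \<ge> 0"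
  using l1_boundD[of c M "{}"] by simp

lemma l1_bound_abs_summable: "l1_bound c M \<Longrightarrow> (\<lambda>p. \<bar>c p\<bar>) summable_on UNIV"
  by (rule nonneg_bdd_above_summable_on) (auto simp: l1_bound_def bdd_above_def)

lemma l1_bound_summable: "l1_bound c M \<Longrightarrow> c summable_on UNIV"
  using l1_bound_abs_summable summable_on_abs_real_iff by blast

lemma l1_bound_infsum_le: "l1_bound c M \<Longrightarrow> (\<Sum>\<^sub>\<infinity>p. \<bar>c p\<bar>) \<le> M"
  by (rule infsum_le_finite_sums[OF l1_bound_abs_summable]) (auto simp: l1_bound_def)

lemma l1_bound_sum:
  assumes "finite I" "\<And>i. i \<in> I \<Longrightarrow> l1_bound (c i) (M i)"
  shows "l1_bound (\<lambda>p. \<Sum>i\<in>I. \<alpha> i * c i p) (\<Sum>i\<in>I. \<bar>\<alpha> i\<bar> * M i)"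
proof (rule l1_boundI)
  fix G :: "'b set" assume G: "finite G"
  have "(\<Sum>p\<in>G. \<bar>\<Sum>i\<in>I. \<alpha> i * c i p\<bar>) \<le> (\<Sum>p\<in>G. \<Sum>i\<in>I. \<bar>\<alpha> i\<bar> * \<bar>c i p\<bar>)"
    by (intro sum_mono order_trans[OF sum_abs]) (simp add: abs_mult)
  also have "\<dots> = (\<Sum>i\<in>I. \<bar>\<alpha> i\<bar> * (\<Sum>p\<in>G. \<bar>c i p\<bar>))"
    unfolding sum_distrib_left by (rule sum.swap)
  also have "\<dots> \<le> (\<Sum>i\<in>I. \<bar>\<alpha> i\<bar> * M i)"
    using assms G by (intro sum_mono mult_left_mono l1_boundD) auto
  finally show "(\<Sum>p\<in>G. \<bar>\<Sum>i\<in>I. \<alpha> i * c i p\<bar>) \<le> (\<Sum>i\<in>I. \<bar>\<alpha> i\<bar> * M i)" .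
qed

text \<open>The case \<open>\<Lambda> = 0\<close> and \<open>j = 0\<close>. What matters is
  uniformity in \<open>n\<close>.\<close>

lemma l1_bound_ballot2: "l1_bound (ballot2 n) (64 * (1 + exp 4) * exp 8)"
  using array_sum_le[OF row_ballot2, of 0 _ n] by (intro l1_boundI) (simp add: case_prod_unfold)

text \<open>
  The coefficients of \<open>L^n\<close>, obtained from \<open>L = 2 (I - (I + P)/2)\<close>.
\<close>

definition laplacian_coeff :: "nat \<Rightarrow> nat \<times> nat \<Rightarrow> real" where
  "laplacian_coeff n p = (\<Sum>j\<le>n. (2 ^ n * real (n choose j) * (- 1) ^ j) * ballot2 j p)"

lemma l1_bound_laplacian_coeff:
  "l1_bound (laplacian_coeff n) (4 ^ n * (64 * (1 + exp 4) * exp 8))"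
proof -
  have "(\<Sum>j\<le>n. \<bar>2 ^ n * real (n choose j) * (- 1) ^ j\<bar> * (64 * (1 + exp 4) * exp 8)) =
      2 ^ n * real (\<Sum>j\<le>n. n choose j) * (64 * (1 + exp 4) * exp 8)"
    by (simp add: abs_mult power_abs sum_distrib_left sum_distrib_right)
  also have "\<dots> = 4 ^ n * (64 * (1 + exp 4) * exp 8)"
    by (simp add: choose_row_sum flip: power_mult_distrib)
  finally show ?thesis
    using l1_bound_sum[of "{..n}" ballot2 "\<lambda>_. 64 * (1 + exp 4) * exp 8"
        "\<lambda>j. 2 ^ n * real (n choose j) * (- 1) ^ j"] l1_bound_ballot2
    unfolding laplacian_coeff_def[abs_def] by simp
qed

text \<open>The semigroup is defined by powers of \<open>L\<close>, the estimates use powers of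
  \<open>(I + P)/2\<close>. The two expansions agree: the first is the Cauchy product of the series
  of \<open>exp (- 2 t)\<close> and \<open>exp (2 t (I + P)/2)\<close>.\<close>

lemma heat_coeff_sums_laplacian:
  assumes t: "t \<ge> 0"
  shows "(\<lambda>n. (- t) ^ n / fact n * laplacian_coeff n p) sums heat_coeff t p"
proof -
  define a where "a = (\<lambda>j. (2 * t) ^ j / fact j * ballot2 j p)"
  define b where "b = (\<lambda>i. (- 2 * t) ^ i / fact i :: real)"
  have a: "summable (\<lambda>j. norm (a j))"
  proof (rule summable_comparison_test'[of "\<lambda>j. (2 * t) ^ j / fact j" 0])
    show "summable (\<lambda>j. (2 * t) ^ j / fact j)" using exp_sums by (rule sums_summable)
    show "norm (norm (a j)) \<le> (2 * t) ^ j / fact j" for j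
    proof -
      have "a j \<le> (2 * t) ^ j / fact j"
        unfolding a_def using t ballot2_le_1[of j p] by (intro mult_left_le) auto
      moreover have "a j \<ge> 0" using t unfolding a_def by (intro mult_nonneg_nonneg) auto
      ultimately show ?thesis by simp
    qed
  qed
  have b: "summable (\<lambda>i. norm (b i))"
    using sums_summable[OF exp_sums[of "2 * t"]] t by (simp add: b_def abs_mult power_abs)
  have "(\<lambda>n. \<Sum>j\<le>n. a j * b (n - j)) sums ((\<Sum>j. a j) * (\<Sum>i. b i))"
    by (rule Cauchy_product_sums[OF a b])
  moreover have "(\<Sum>j\<le>n. a j * b (n - j)) = (- t) ^ n / fact n * laplacian_coeff n p" for n
    unfolding laplacian_coeff_def sum_distrib_left
  proof (intro sum.cong refl)
    fix j assume "j \<in> {..n}"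
    then have j: "j \<le> n" by simp
    have "(2 * t) ^ j = ((- 1) * (- 2 * t)) ^ j" by simp
    also have "\<dots> = (- 1) ^ j * (- 2 * t) ^ j" by (rule power_mult_distrib)
    finally have "(2 * t) ^ j * (- 2 * t) ^ (n - j) = (- 1) ^ j * ((- 2 * t) ^ j * (- 2 * t) ^ (n - j))"
      by (simp only: mult.assoc)
    also have "(- 2 * t) ^ j * (- 2 * t) ^ (n - j) = ((- t) * 2) ^ n"
      using j by (simp flip: power_add add: mult.commute[of t 2])
    also have "\<dots> = (- t) ^ n * 2 ^ n" by (rule power_mult_distrib)
    finally have 1: "(2 * t) ^ j * (- 2 * t) ^ (n - j) = (- 1) ^ j * ((- t) ^ n * 2 ^ n)" .
    have "a j * b (n - j) = ((2 * t) ^ j * (- 2 * t) ^ (n - j)) / (fact j * fact (n - j)) * ballot2 j p"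
      by (simp add: a_def b_def)
    also have "\<dots> = (- t) ^ n / fact n * (2 ^ n * real (n choose j) * (- 1) ^ j * ballot2 j p)"
      unfolding 1 binomial_fact[OF j] by simp
    finally show "a j * b (n - j) = (- t) ^ n / fact n * (2 ^ n * real (n choose j) * (- 1) ^ j * ballot2 j p)" .
  qed
  moreover have "(\<Sum>j. a j) * (\<Sum>i. b i) = heat_coeff t p"
  proof -
    have "(\<Sum>i. b i) = exp (- 2 * t)" unfolding b_def using exp_sums sums_unique by metis
    moreover have "(\<lambda>n. exp (- 2 * t) * a n) sums heat_coeff t p"
      using heat_coeff_sums[OF t, of p] by (simp add: a_def poisson_weight_def mult_ac)
    ultimately show ?thesis
      using suminf_mult[OF summable_norm_cancel[OF a], of "exp (- 2 * t)"] by (simp add: sums_iff mult.commute)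
  qed
  ultimately show ?thesis by simp
qed

text \<open>Convergence of the exponential series in l1 norm, which \<open>schur_test\<close> later
  turns into convergence on \<open>L2_flow\<close>.\<close>

lemma heat_coeff_partial_sums:
  assumes t: "t \<ge> 0"
  obtains \<tau> where "\<tau> \<longlonglongrightarrow> 0"
    "\<And>N. l1_bound (\<lambda>p. (\<Sum>n<N. (- t) ^ n / fact n * laplacian_coeff n p) - heat_coeff t p) (\<tau> N)"
proof
  define B :: real where "B = 64 * (1 + exp 4) * exp 8"
  \<comment> \<open>The factor \<open>4 ^ n\<close> is the growth of the l1 bounds of
    \<open>L^n\<close>; the error is a tail of this exponential series.\<close>
  define u where "u = (\<lambda>n. (4 * t) ^ n / fact n * B)"
  have u: "summable u" unfolding u_def using sums_summable[OF exp_sums] by (rule summable_mult2)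
  show "(\<lambda>N. suminf u - (\<Sum>n<N. u n)) \<longlonglongrightarrow> 0"
    using tendsto_diff[OF tendsto_const[of "suminf u"] summable_LIMSEQ[OF u]] by simp
  fix N
  show "l1_bound (\<lambda>p. (\<Sum>n<N. (- t) ^ n / fact n * laplacian_coeff n p) - heat_coeff t p)
      (suminf u - (\<Sum>n<N. u n))"
  proof (rule l1_boundI)
    fix G :: "(nat \<times> nat) set" assume G: "finite G"
    define e where "e = (\<lambda>p n. (- t) ^ n / fact n * laplacian_coeff n p)"
    have Gu: "(\<Sum>p\<in>G. \<bar>e p n\<bar>) \<le> u n" for n
    proof -
      have "(\<Sum>p\<in>G. \<bar>e p n\<bar>) = t ^ n / fact n * (\<Sum>p\<in>G. \<bar>laplacian_coeff n p\<bar>)"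
        using t by (simp add: e_def abs_mult power_abs sum_distrib_left)
      also have "\<dots> \<le> t ^ n / fact n * (4 ^ n * B)"
        unfolding B_def using t G by (intro mult_left_mono l1_boundD[OF l1_bound_laplacian_coeff]) auto
      also have "\<dots> = u n" by (simp add: u_def power_mult_distrib)
      finally show ?thesis .
    qed
    have us: "summable (\<lambda>n. u (n + N))" using u by (simp add: summable_iff_shift)
    have es: "summable (\<lambda>n. \<bar>e p (n + N)\<bar>)" if "p \<in> G" for p
    proof (rule summable_comparison_test'[OF us, of 0])
      show "norm \<bar>e p (n + N)\<bar> \<le> u (n + N)" for n
        using member_le_sum[OF that, of "\<lambda>p. \<bar>e p (n + N)\<bar>"] G Gu[of "n + N"] by simp
    qed
    have "\<bar>(\<Sum>n<N. e p n) - heat_coeff t p\<bar> \<le> (\<Sum>n. \<bar>e p (n + N)\<bar>)" if "p \<in> G" for p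
    proof -
      have s: "e p sums heat_coeff t p" unfolding e_def by (rule heat_coeff_sums_laplacian[OF t])
      then have "heat_coeff t p = (\<Sum>n. e p (n + N)) + (\<Sum>n<N. e p n)"
        using suminf_split_initial_segment[of "e p" N] by (simp add: sums_iff)
      then show ?thesis using summable_rabs[OF es[OF that]] by simp
    qed
    then have "(\<Sum>p\<in>G. \<bar>(\<Sum>n<N. e p n) - heat_coeff t p\<bar>) \<le> (\<Sum>p\<in>G. \<Sum>n. \<bar>e p (n + N)\<bar>)"
      by (rule sum_mono)
    also have "\<dots> = (\<Sum>n. \<Sum>p\<in>G. \<bar>e p (n + N)\<bar>)"
      by (rule suminf_sum[symmetric]) (rule es)
    also have "\<dots> \<le> (\<Sum>n. u (n + N))"
      by (intro suminf_le Gu summable_sum es us)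
    also have "\<dots> = suminf u - (\<Sum>n<N. u n)" by (rule suminf_minus_initial_segment[OF u])
    finally show "(\<Sum>p\<in>G. \<bar>(\<Sum>n<N. (- t) ^ n / fact n * laplacian_coeff n p) - heat_coeff t p\<bar>) \<le>
        suminf u - (\<Sum>n<N. u n)"
      by (simp add: e_def)
  qed
qed

text \<open>An iterated difference gains one order by Pascal's rule. This is the passage from
  \<open>L^n\<close> to \<open>L^(n + 1)\<close>.\<close>

lemma binomial_alternating_sum_Suc:
  fixes g :: "nat \<Rightarrow> 'b::comm_ring_1"
  shows "(\<Sum>j\<le>Suc n. of_nat (Suc n choose j) * (- 1) ^ j * g j) =
    (\<Sum>j\<le>n. of_nat (n choose j) * (- 1) ^ j * (g j - g (Suc j)))"
proof -
  \<comment> \<open>The binomial index is kept apart from that of \<open>g\<close>, so that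
    \<open>h\<close> expresses both terms of Pascal's rule.\<close>
  define h where "h = (\<lambda>k j. of_nat (n choose k) * (- 1) ^ j * g j)"
  have "(\<Sum>j\<le>Suc n. of_nat (Suc n choose j) * (- 1) ^ j * g j) =
      g 0 + (\<Sum>j\<le>n. h j (Suc j) + h (Suc j) (Suc j))"
    by (subst sum.atMost_Suc_shift) (simp add: h_def algebra_simps)
  also have "\<dots> = (g 0 + (\<Sum>j\<le>n. h (Suc j) (Suc j))) + (\<Sum>j\<le>n. h j (Suc j))"
    by (simp add: sum.distrib)
  also have "g 0 + (\<Sum>j\<le>n. h (Suc j) (Suc j)) = (\<Sum>j\<le>Suc n. h j j)"
    by (subst sum.atMost_Suc_shift) (simp add: h_def)
  also have "\<dots> = (\<Sum>j\<le>n. h j j)" by (simp add: h_def binomial_eq_0)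
  also have "(\<Sum>j\<le>n. h j j) + (\<Sum>j\<le>n. h j (Suc j)) =
      (\<Sum>j\<le>n. of_nat (n choose j) * (- 1) ^ j * (g j - g (Suc j)))"
    by (simp add: h_def right_diff_distrib sum_subtractf sum_negf)
  finally show ?thesis .
qed

lemma summable_diff_fst: "c summable_on UNIV \<Longrightarrow> diff_fst c summable_on UNIV"
proof -
  assume "c summable_on UNIV"
  then have "(c has_sum infsum c UNIV) UNIV" by (rule has_sum_infsum)
  from has_sum_diff_real[OF this has_sum_shift_fst[OF this]]
  show ?thesis
    by (intro has_sum_imp_summable) (auto simp: diff_fst_def case_prod_unfold)
qed

section \<open>Boundedness on \<open>L2_flow\<close> of operators with l1 coefficients\<close>

context flow_tree begin

lemma kernel_mass:
  assumes "l1_bound c M" "finite F"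
  shows "(\<Sum>x\<in>F. \<bar>kernel c x y\<bar> * flow_measure x) \<le> M"
  using kernel_weighted_sum_le[of 0 F c M y] assms l1_boundD[OF assms(1)]
  by (simp add: case_prod_unfold)

lemma kernel_swap:
  assumes "c summable_on UNIV"
  shows "kernel (\<lambda>(a, b). c (b, a)) y x = kernel c x y"
proof (rule kernel_eqI)
  show "((\<lambda>(a, b). (case (a, b) of (a, b) \<Rightarrow> c (b, a)) * climb a b y x) has_sum kernel c x y) UNIV"
    using has_sum_swap_pair[OF kernel_has_sum[OF assms, of x y]] by (simp add: climb_sym[of _ _ y x])
qed

text \<open>Exchanging \<open>a\<close> and \<open>b\<close> transposes the kernel and preserves the
  l1 bound.\<close>

lemma kernel_mass_snd:
  assumes "l1_bound c M" "finite F"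
  shows "(\<Sum>y\<in>F. \<bar>kernel c x y\<bar> * flow_measure y) \<le> M"
proof -
  have "l1_bound (\<lambda>(a, b). c (b, a)) M"
  proof (rule l1_boundI)
    fix G :: "(nat \<times> nat) set" assume G: "finite G"
    have "(\<Sum>p\<in>G. \<bar>case p of (a, b) \<Rightarrow> c (b, a)\<bar>) = (\<Sum>p\<in>prod.swap ` G. \<bar>c p\<bar>)"
      by (subst sum.reindex) (auto simp: case_prod_unfold prod.swap_def)
    then show "(\<Sum>p\<in>G. \<bar>case p of (a, b) \<Rightarrow> c (b, a)\<bar>) \<le> M"
      using l1_boundD[OF assms(1)] G by simp
  qed
  from kernel_mass[OF this assms(2), of x] show ?thesis
    by (simp add: kernel_swap[OF l1_bound_summable[OF assms(1)]])
qed

lemma kernel_le: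
  assumes "l1_bound c M"
  shows "\<bar>kernel c x y\<bar> \<le> M / flow_measure x"
  using kernel_mass[OF assms, of "{x}" y] by (simp add: le_divide_eq)

definition apply_kernel :: "(nat \<times> nat \<Rightarrow> real) \<Rightarrow> ('a \<Rightarrow> complex) \<Rightarrow> 'a \<Rightarrow> complex" where
  "apply_kernel c f x = (\<Sum>\<^sub>\<infinity>y. of_real (kernel c x y) * f y * of_real (flow_measure y))"

text \<open>The last claim is Cauchy-Schwarz for a measure of mass at most \<open>M\<close>, derived
  from a quadratic inequality valid for every real \<open>r\<close>.\<close>

lemma
  assumes c: "l1_bound c M" and f: "f \<in> L2_flow"
  shows kernel_square_summable:
      "(\<lambda>y. \<bar>kernel c x y\<bar> * (cmod (f y))\<^sup>2 * flow_measure y) summable_on UNIV" (is "?B summable_on _")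
    and apply_kernel_has_sum:
      "((\<lambda>y. of_real (kernel c x y) * f y * of_real (flow_measure y)) has_sum apply_kernel c f x) UNIV"
    and norm_apply_kernel_le:
      "(cmod (apply_kernel c f x))\<^sup>2 \<le> M * (\<Sum>\<^sub>\<infinity>y. \<bar>kernel c x y\<bar> * (cmod (f y))\<^sup>2 * flow_measure y)"
proof -
  let ?S = "\<lambda>y. \<bar>kernel c x y\<bar> * cmod (f y) * flow_measure y"
  have f2: "(\<lambda>y. (cmod (f y))\<^sup>2 * flow_measure y) summable_on UNIV" using f by (simp add: L2_flow_def)
  show B: "?B summable_on UNIV"
  proof (rule summable_on_comparison_test)
    show "(\<lambda>y. M / flow_measure x * ((cmod (f y))\<^sup>2 * flow_measure y)) summable_on UNIV"
      by (rule summable_on_cmult_right[OF f2])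
    show "?B y \<le> M / flow_measure x * ((cmod (f y))\<^sup>2 * flow_measure y)" for y
      using mult_right_mono[OF kernel_le[OF c, of x y], of "(cmod (f y))\<^sup>2 * flow_measure y"]
      by (simp add: mult.assoc)
  qed auto
  have A: "l1_bound (\<lambda>y. kernel c x y * flow_measure y) M"
    using kernel_mass_snd[OF c] by (intro l1_boundI) (simp add: abs_mult)
  define A' where "A' = (\<lambda>y. \<bar>kernel c x y * flow_measure y\<bar>)"
  have A': "A' summable_on UNIV" unfolding A'_def by (rule l1_bound_abs_summable[OF A])
  have amgm: "2 * s * ?S y \<le> s\<^sup>2 * A' y + ?B y" for s y
  proof -
    have "2 * s * cmod (f y) \<le> s\<^sup>2 + (cmod (f y))\<^sup>2"
      using zero_le_power2[of "s - cmod (f y)"] unfolding power2_diff by simp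
    then have "\<bar>kernel c x y\<bar> * flow_measure y * (2 * s * cmod (f y)) \<le>
        \<bar>kernel c x y\<bar> * flow_measure y * (s\<^sup>2 + (cmod (f y))\<^sup>2)"
      by (intro mult_left_mono) auto
    then show ?thesis by (simp add: A'_def abs_mult algebra_simps)
  qed
  have S: "?S summable_on UNIV"
  proof (rule summable_on_comparison_test)
    show "(\<lambda>y. A' y + ?B y) summable_on UNIV" by (rule summable_on_add[OF A' B])
    show "?S y \<le> A' y + ?B y" for y
    proof -
      \<comment> \<open>With \<open>s = 1\<close>, \<open>amgm\<close> dominates \<open>?S\<close>
        by a sum of two summable families.\<close>
      have le: "u \<le> v" if "2 * 1 * u \<le> 1\<^sup>2 * w + v'" "u \<ge> 0" "v = w + v'" for u v w v' :: real
        using that by simp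
      show ?thesis by (rule le[OF amgm]) simp_all
    qed
  qed auto
  have norm: "norm (of_real (kernel c x y) * f y * of_real (flow_measure y)) = ?S y" for y
    by (simp add: norm_mult)
  show "((\<lambda>y. of_real (kernel c x y) * f y * of_real (flow_measure y)) has_sum apply_kernel c f x) UNIV"
    unfolding apply_kernel_def by (rule has_sum_infsum, rule abs_summable_summable) (simp only: norm S)
  define s where "s = infsum ?S UNIV"
  have s: "cmod (apply_kernel c f x) \<le> s"
    unfolding apply_kernel_def s_def
    using norm_infsum_bound[of "\<lambda>y. of_real (kernel c x y) * f y * of_real (flow_measure y)" UNIV]
    unfolding norm using S by simp
  have b: "infsum ?B UNIV \<ge> 0" by (intro infsum_nonneg) simp
  have M: "M \<ge> 0" using c by (rule l1_bound_nonneg)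
  have quad: "2 * r * s \<le> r\<^sup>2 * M + infsum ?B UNIV" for r
  proof -
    have "2 * r * s = (\<Sum>\<^sub>\<infinity>y. 2 * r * ?S y)" unfolding s_def by (rule infsum_cmult_right[symmetric]) (rule S)
    also have "\<dots> \<le> (\<Sum>\<^sub>\<infinity>y. r\<^sup>2 * A' y + ?B y)"
      by (intro infsum_mono summable_on_cmult_right summable_on_add S A' B amgm)
    also have "\<dots> = r\<^sup>2 * infsum A' UNIV + infsum ?B UNIV"
      by (simp add: infsum_add summable_on_cmult_right A' B infsum_cmult_right)
    also have "\<dots> \<le> r\<^sup>2 * M + infsum ?B UNIV"
      unfolding A'_def by (intro add_right_mono mult_left_mono l1_bound_infsum_le[OF A]) auto
    finally show ?thesis .
  qed
  have "s\<^sup>2 \<le> M * infsum ?B UNIV"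
  proof (cases "M = 0")
    case True
    have "s \<le> 0"
    proof (rule ccontr)
      assume "\<not> s \<le> 0"
      \<comment> \<open>If \<open>M = 0\<close>, this choice of \<open>r\<close> in
        \<open>quad\<close> would give \<open>2 (B + 1) \<le> B\<close> with
        \<open>B \<ge> 0\<close>.\<close>
      then have "2 * ((infsum ?B UNIV + 1) / s) * s = 2 * (infsum ?B UNIV + 1)" by simp
      then show False using quad[of "(infsum ?B UNIV + 1) / s"] True b by simp
    qed
    moreover have "s \<ge> 0" using s norm_ge_zero order_trans by blast
    ultimately show ?thesis using True by simp
  next
    case False
    \<comment> \<open>The choice \<open>r = s / M\<close> is the optimal one.\<close>
    have "M * (2 * (s / M) * s) \<le> M * ((s / M)\<^sup>2 * M + infsum ?B UNIV)"
      by (rule mult_left_mono[OF quad M])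
    moreover have "M * (2 * (s / M) * s) = 2 * s\<^sup>2" "M * ((s / M)\<^sup>2 * M) = s\<^sup>2"
      using False by (simp_all add: power2_eq_square)
    ultimately show ?thesis by (simp add: distrib_left)
  qed
  moreover have "(cmod (apply_kernel c f x))\<^sup>2 \<le> s\<^sup>2" using s by (intro power_mono) auto
  ultimately show "(cmod (apply_kernel c f x))\<^sup>2 \<le> M * infsum ?B UNIV" by linarith
qed

text \<open>One factor \<open>M\<close> comes from the mass in \<open>y\<close>, through the
  pointwise bound, the other from the mass in \<open>x\<close> when summing over
  \<open>x\<close>.\<close>

lemma schur_test:
  assumes c: "l1_bound c M" and f: "f \<in> L2_flow"
  shows "apply_kernel c f \<in> L2_flow" and "L2_flow_norm (apply_kernel c f) \<le> M * L2_flow_norm f"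
proof -
  define n where "n = (\<Sum>\<^sub>\<infinity>y. (cmod (f y))\<^sup>2 * flow_measure y)"
  have f2: "(\<lambda>y. (cmod (f y))\<^sup>2 * flow_measure y) summable_on UNIV" using f by (simp add: L2_flow_def)
  have M: "M \<ge> 0" using c by (rule l1_bound_nonneg)
  define g where "g = (\<lambda>x. (cmod (apply_kernel c f x))\<^sup>2 * flow_measure x)"
  define h where "h = (\<lambda>x y. \<bar>kernel c x y\<bar> * (cmod (f y))\<^sup>2 * flow_measure y)"
  have bound: "sum g F \<le> M\<^sup>2 * n" if F: "finite F" for F
  proof -
    have h: "(\<lambda>y. h x y * flow_measure x) summable_on UNIV" for x
      unfolding h_def by (rule summable_on_cmult_left[OF kernel_square_summable[OF c f]])
    have "sum g F \<le> (\<Sum>x\<in>F. M * (\<Sum>\<^sub>\<infinity>y. h x y * flow_measure x))"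
    proof (rule sum_mono)
      fix x
      have "g x \<le> M * infsum (h x) UNIV * flow_measure x"
        unfolding g_def h_def by (rule mult_right_mono[OF norm_apply_kernel_le[OF c f]]) simp
      then show "g x \<le> M * (\<Sum>\<^sub>\<infinity>y. h x y * flow_measure x)"
        by (simp add: infsum_cmult_left' mult.assoc)
    qed
    also have "\<dots> = M * (\<Sum>\<^sub>\<infinity>y. \<Sum>x\<in>F. h x y * flow_measure x)"
      using infsumI[OF has_sum_finite_sum[OF has_sum_infsum[OF h], where I = F]]
      by (simp add: sum_distrib_left)
    also have "\<dots> \<le> M * (\<Sum>\<^sub>\<infinity>y. M * ((cmod (f y))\<^sup>2 * flow_measure y))"
    proof (intro mult_left_mono infsum_mono M)
      show "(\<lambda>y. \<Sum>x\<in>F. h x y * flow_measure x) summable_on UNIV"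
        by (rule has_sum_imp_summable[OF has_sum_finite_sum[OF has_sum_infsum[OF h]]])
      show "(\<lambda>y. M * ((cmod (f y))\<^sup>2 * flow_measure y)) summable_on UNIV"
        by (rule summable_on_cmult_right[OF f2])
      fix y
      have "(\<Sum>x\<in>F. h x y * flow_measure x) =
          (\<Sum>x\<in>F. \<bar>kernel c x y\<bar> * flow_measure x) * ((cmod (f y))\<^sup>2 * flow_measure y)"
        unfolding h_def sum_distrib_right by (intro sum.cong refl) (simp add: mult_ac)
      also have "\<dots> \<le> M * ((cmod (f y))\<^sup>2 * flow_measure y)"
        by (rule mult_right_mono[OF kernel_mass[OF c F]]) simp
      finally show "(\<Sum>x\<in>F. h x y * flow_measure x) \<le> M * ((cmod (f y))\<^sup>2 * flow_measure y)" .
    qed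
    also have "\<dots> = M\<^sup>2 * n"
      unfolding n_def by (simp add: infsum_cmult_right' power2_eq_square)
    finally show ?thesis .
  qed
  have g: "g summable_on UNIV"
    by (rule nonneg_bdd_above_summable_on) (use bound in \<open>auto simp: g_def bdd_above_def\<close>)
  then show "apply_kernel c f \<in> L2_flow" by (simp add: L2_flow_def g_def)
  have "infsum g UNIV \<le> M\<^sup>2 * n" by (rule infsum_le_finite_sums[OF g]) (use bound in auto)
  then have "sqrt (infsum g UNIV) \<le> M * sqrt n"
    using M real_sqrt_le_mono[of "infsum g UNIV" "M\<^sup>2 * n"] by (simp add: real_sqrt_mult)
  then show "L2_flow_norm (apply_kernel c f) \<le> M * L2_flow_norm f"
    by (simp add: L2_flow_norm_def g_def n_def)
qed

lemma kernel_sum: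
  assumes "\<And>i. i \<in> I \<Longrightarrow> c i summable_on UNIV"
  shows "kernel (\<lambda>p. \<Sum>i\<in>I. \<alpha> i * c i p) x y = (\<Sum>i\<in>I. \<alpha> i * kernel (c i) x y)"
proof (rule kernel_eqI)
  have "((\<lambda>p. \<Sum>i\<in>I. \<alpha> i * (case p of (a, b) \<Rightarrow> c i (a, b) * climb a b x y)) has_sum
      (\<Sum>i\<in>I. \<alpha> i * kernel (c i) x y)) UNIV"
    by (intro has_sum_finite_sum has_sum_cmult_right kernel_has_sum assms)
  then show "((\<lambda>(a, b). (\<Sum>i\<in>I. \<alpha> i * c i (a, b)) * climb a b x y) has_sum
      (\<Sum>i\<in>I. \<alpha> i * kernel (c i) x y)) UNIV"
    by (simp add: case_prod_unfold sum_distrib_right mult.assoc)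
qed

lemma kernel_diff:
  assumes "c summable_on UNIV" "d summable_on UNIV"
  shows "kernel (\<lambda>p. c p - d p) x y = kernel c x y - kernel d x y"
  using has_sum_diff_real[OF kernel_has_sum[OF assms(1), of x y] kernel_has_sum[OF assms(2), of x y]]
  by (intro kernel_eqI) (simp add: case_prod_unfold left_diff_distrib)

lemma apply_kernel_sum:
  assumes "\<And>i. i \<in> I \<Longrightarrow> l1_bound (c i) (M i)" "f \<in> L2_flow"
  shows "apply_kernel (\<lambda>p. \<Sum>i\<in>I. \<alpha> i * c i p) f x = (\<Sum>i\<in>I. of_real (\<alpha> i) * apply_kernel (c i) f x)"
proof -
  have "((\<lambda>y. \<Sum>i\<in>I. of_real (\<alpha> i) * (of_real (kernel (c i) x y) * f y * of_real (flow_measure y))) has_sum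
      (\<Sum>i\<in>I. of_real (\<alpha> i) * apply_kernel (c i) f x)) UNIV"
    by (intro has_sum_finite_sum has_sum_cmult_right apply_kernel_has_sum[OF assms(1) assms(2)])
  moreover have "kernel (\<lambda>p. \<Sum>i\<in>I. \<alpha> i * c i p) x y = (\<Sum>i\<in>I. \<alpha> i * kernel (c i) x y)" for y
    by (intro kernel_sum l1_bound_summable[OF assms(1)])
  ultimately show ?thesis
    unfolding apply_kernel_def[of "\<lambda>p. \<Sum>i\<in>I. \<alpha> i * c i p"]
    by (intro infsumI) (simp add: sum_distrib_right mult.assoc)
qed

lemma apply_kernel_diff:
  assumes c: "l1_bound c M" and d: "l1_bound d M'" and f: "f \<in> L2_flow"
  shows "apply_kernel (\<lambda>p. c p - d p) f x = apply_kernel c f x - apply_kernel d f x"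
proof -
  have "((\<lambda>y. of_real (kernel c x y) * f y * of_real (flow_measure y) +
      - (of_real (kernel d x y) * f y * of_real (flow_measure y))) has_sum
      (apply_kernel c f x + - apply_kernel d f x)) UNIV"
    by (intro has_sum_add has_sum_uminusI apply_kernel_has_sum[OF c f] apply_kernel_has_sum[OF d f])
  then show ?thesis
    unfolding apply_kernel_def[of "\<lambda>p. c p - d p"] kernel_diff[OF l1_bound_summable[OF c] l1_bound_summable[OF d]]
    by (intro infsumI) (simp add: left_diff_distrib)
qed

section \<open>Powers of the flow Laplacian\<close>

lemma flow_laplacian_eq:
  "flow_laplacian f x = f x - (f (predecessor x) + (\<Sum>z\<in>children x. f z) / of_nat q) / 2"
proof -
  have sq: "sqrt (real q) > 0" using q_pos by simp
  \<comment> \<open>Multiplied by the prefactor \<open>1 / (2 * sqrt q)\<close>, the weights become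
    \<open>1 / 2\<close> for the predecessor and \<open>1 / (2 * q)\<close> for each child.\<close>
  have up: "sqrt (flow_measure (predecessor x)) / sqrt (flow_measure x) = sqrt (real q)"
    by (simp add: flow_measure_predecessor real_sqrt_mult)
  have down: "sqrt (flow_measure z) / sqrt (flow_measure x) = 1 / sqrt (real q)" if "z \<in> children x" for z
    using that sq by (auto simp: children_def flow_measure_predecessor real_sqrt_mult)
  have "(\<Sum>y | adj x y. of_real (sqrt (flow_measure y) / sqrt (flow_measure x)) * f y) =
      of_real (sqrt (real q)) * f (predecessor x) + (\<Sum>z\<in>children x. of_real (1 / sqrt (real q)) * f z)"
    unfolding neighbours_eq by (simp add: predecessor_notin_children up down del: of_real_divide)
  also have "\<dots> = of_real (sqrt (real q)) * f (predecessor x) + of_real (1 / sqrt (real q)) * (\<Sum>z\<in>children x. f z)"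
    by (simp only: sum_distrib_left)
  finally have "of_real (1 / (2 * sqrt (real q))) *
      (\<Sum>y | adj x y. of_real (sqrt (flow_measure y) / sqrt (flow_measure x)) * f y) =
      of_real (1 / (2 * sqrt (real q)) * sqrt (real q)) * f (predecessor x) +
      of_real (1 / (2 * sqrt (real q)) * (1 / sqrt (real q))) * (\<Sum>z\<in>children x. f z)"
    by (simp only: distrib_left mult.assoc of_real_mult)
  also have "1 / (2 * sqrt (real q)) * sqrt (real q) = 1 / 2" using sq by simp
  also have "1 / (2 * sqrt (real q)) * (1 / sqrt (real q)) = 1 / (2 * real q)" using q_pos by simp
  finally show ?thesis unfolding flow_laplacian_def by (simp add: add_divide_distrib)
qed

lemma flow_laplacian_sum:
  "flow_laplacian (\<lambda>x. \<Sum>i\<in>I. \<alpha> i * g i x) = (\<lambda>x. \<Sum>i\<in>I. \<alpha> i * flow_laplacian (g i) x)"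
proof
  fix x
  have "(\<Sum>z\<in>children x. \<Sum>i\<in>I. \<alpha> i * g i z) = (\<Sum>i\<in>I. \<alpha> i * (\<Sum>z\<in>children x. g i z))"
    unfolding sum_distrib_left by (rule sum.swap)
  then show "flow_laplacian (\<lambda>x. \<Sum>i\<in>I. \<alpha> i * g i x) x = (\<Sum>i\<in>I. \<alpha> i * flow_laplacian (g i) x)"
    unfolding flow_laplacian_eq
    by (simp add: right_diff_distrib distrib_left sum_subtractf sum.distrib flip: sum_divide_distrib)
qed

text \<open>This says \<open>K_(n+1) = (I + P)/2 K_n\<close>. With \<open>k = a + b\<close>, the
  steps \<open>U\<close> and \<open>D\<close> bring to each entry the values at \<open>k - 1\<close>
  and \<open>k + 1\<close>, only the corner getting nothing from below: these are the ballot
  recurrences.\<close>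

lemma kernel_ballot2_Suc:
  "kernel (ballot2 n) (predecessor x) y + (\<Sum>z\<in>children x. kernel (ballot2 n) z y) / real q =
     4 * kernel (ballot2 (Suc n)) x y - 2 * kernel (ballot2 n) x y"
proof -
  note s = l1_bound_summable[OF l1_bound_ballot2]
  have "avg_coeff (ballot2 n) p + (ballot2 n p - diff_fst (ballot2 n) p) = 4 * ballot2 (Suc n) p - 2 * ballot2 n p" for p
  proof (cases p)
    case (Pair a b)
    show ?thesis
      unfolding Pair by (cases a; cases b)
        (simp_all add: avg_coeff_def diff_fst_def ballot2_def ballot_Suc_0 ballot_Suc_Suc)
  qed
  \<comment> \<open>The finite sum is the form that \<open>kernel_sum\<close> takes. As
    \<open>diff_fst\<close> is the array minus its shift, \<open>ballot2 n\<close> gets the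
    coefficient \<open>- 2 - 1 = - 3\<close>.\<close>
  then have avg: "avg_coeff (ballot2 n) = (\<lambda>p. (\<Sum>i\<in>{0, 1, 2 :: nat}. (if i = 0 then 4 else if i = 1 then - 3 else 1) *
      (if i = 0 then ballot2 (Suc n) else if i = 1 then ballot2 n else diff_fst (ballot2 n)) p))"
    by (auto simp: fun_eq_iff algebra_simps)
  have "kernel (avg_coeff (ballot2 n)) x y =
      4 * kernel (ballot2 (Suc n)) x y - 3 * kernel (ballot2 n) x y + kernel (diff_fst (ballot2 n)) x y"
    unfolding avg by (subst kernel_sum) (auto intro: s summable_diff_fst[OF s])
  then show ?thesis unfolding kernel_children[OF s] kernel_diff_fst[OF s] by simp
qed

lemma flow_laplacian_apply_ballot2:
  assumes f: "f \<in> L2_flow"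
  shows "flow_laplacian (apply_kernel (ballot2 n) f) x =
    2 * apply_kernel (ballot2 n) f x - 2 * apply_kernel (ballot2 (Suc n)) f x"
proof -
  note h = apply_kernel_has_sum[OF l1_bound_ballot2 f]
  define g where "g = (\<lambda>n x y. of_real (kernel (ballot2 n) x y) * f y * of_real (flow_measure y))"
  have "((\<lambda>y. g n (predecessor x) y + (\<Sum>z\<in>children x. g n z y) / of_nat q) has_sum
      (apply_kernel (ballot2 n) f (predecessor x) + (\<Sum>z\<in>children x. apply_kernel (ballot2 n) f z) / of_nat q)) UNIV"
    unfolding g_def by (intro has_sum_add has_sum_divide_const has_sum_finite_sum h)
  moreover have "g n (predecessor x) y + (\<Sum>z\<in>children x. g n z y) / of_nat q = 4 * g (Suc n) x y + (- 2) * g n x y" for y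
  proof -
    have "g n (predecessor x) y + (\<Sum>z\<in>children x. g n z y) / of_nat q =
        of_real (kernel (ballot2 n) (predecessor x) y + (\<Sum>z\<in>children x. kernel (ballot2 n) z y) / real q) *
          f y * of_real (flow_measure y)"
      by (simp add: g_def distrib_right sum_distrib_right)
    then show ?thesis unfolding kernel_ballot2_Suc by (simp add: g_def left_diff_distrib)
  qed
  ultimately have "((\<lambda>y. 4 * g (Suc n) x y + (- 2) * g n x y) has_sum
      (apply_kernel (ballot2 n) f (predecessor x) + (\<Sum>z\<in>children x. apply_kernel (ballot2 n) f z) / of_nat q)) UNIV"
    by simp
  moreover have "((\<lambda>y. 4 * g (Suc n) x y + (- 2) * g n x y) has_sum
      (4 * apply_kernel (ballot2 (Suc n)) f x + (- 2) * apply_kernel (ballot2 n) f x)) UNIV"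
    unfolding g_def by (intro has_sum_add has_sum_cmult_right h)
  ultimately have "apply_kernel (ballot2 n) f (predecessor x) + (\<Sum>z\<in>children x. apply_kernel (ballot2 n) f z) / of_nat q =
      4 * apply_kernel (ballot2 (Suc n)) f x + (- 2) * apply_kernel (ballot2 n) f x"
    by (rule has_sum_unique)
  then show ?thesis unfolding flow_laplacian_eq by (simp add: diff_divide_distrib)
qed

lemma kernel_ballot2_0: "kernel (ballot2 0) x y = (if x = y then 1 / flow_measure x else 0)"
proof (rule kernel_eqI)
  show "((\<lambda>(a, b). ballot2 0 (a, b) * climb a b x y) has_sum
      (if x = y then 1 / flow_measure x else 0)) UNIV"
  proof (rule has_sum_finite_neutralI[where B = "{(0, 0)}"])
    show "(if x = y then 1 / flow_measure x else 0) = (\<Sum>(a, b)\<in>{(0, 0)}. ballot2 0 (a, b) * climb a b x y)"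
      by (simp add: ballot2_def ballot_0 climb_def)
  qed (auto simp: ballot2_def ballot_0 split: if_splits)
qed

lemma apply_kernel_ballot2_0: "apply_kernel (ballot2 0) f = f"
proof
  fix x
  have "((\<lambda>y. of_real (kernel (ballot2 0) x y) * f y * of_real (flow_measure y)) has_sum
      (\<Sum>y\<in>{x}. of_real (kernel (ballot2 0) x y) * f y * of_real (flow_measure y))) UNIV"
    by (rule has_sum_finite_neutralI[where B = "{x}"]) (auto simp: kernel_ballot2_0)
  then show "apply_kernel (ballot2 0) f x = f x"
    unfolding apply_kernel_def by (intro infsumI) (simp add: kernel_ballot2_0)
qed

text \<open>Each factor \<open>L\<close> replaces \<open>K_j\<close> by
  \<open>2 (K_j - K_(j+1))\<close>, which \<open>binomial_alternating_sum_Suc\<close>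
  collects.\<close>

lemma flow_laplacian_funpow:
  assumes f: "f \<in> L2_flow"
  shows "(flow_laplacian ^^ n) f = apply_kernel (laplacian_coeff n) f"
proof -
  have eq: "apply_kernel (laplacian_coeff n) f =
      (\<lambda>x. \<Sum>j\<le>n. (2 ^ n * of_nat (n choose j) * (- 1) ^ j) * apply_kernel (ballot2 j) f x)" for n
    unfolding laplacian_coeff_def[abs_def]
    using apply_kernel_sum[of "{..n}" ballot2 "\<lambda>_. 64 * (1 + exp 4) * exp 8" f
        "\<lambda>j. 2 ^ n * real (n choose j) * (- 1) ^ j"] l1_bound_ballot2 f
    by (simp add: fun_eq_iff)
  show ?thesis
  proof (induction n)
    case 0
    show ?case unfolding eq by (simp add: apply_kernel_ballot2_0)
  next
    case (Suc n)
    have "(flow_laplacian ^^ Suc n) f = flow_laplacian (apply_kernel (laplacian_coeff n) f)"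
      using Suc by simp
    also have "\<dots> = (\<lambda>x. \<Sum>j\<le>n. (2 ^ n * of_nat (n choose j) * (- 1) ^ j) *
        (2 * apply_kernel (ballot2 j) f x - 2 * apply_kernel (ballot2 (Suc j)) f x))"
      unfolding eq flow_laplacian_sum flow_laplacian_apply_ballot2[OF f] ..
    also have "\<dots> = (\<lambda>x. 2 ^ Suc n * (\<Sum>j\<le>n. of_nat (n choose j) * (- 1) ^ j *
        (apply_kernel (ballot2 j) f x - apply_kernel (ballot2 (Suc j)) f x)))"
      by (simp add: sum_distrib_left fun_eq_iff algebra_simps)
    also have "\<dots> = (\<lambda>x. 2 ^ Suc n * (\<Sum>j\<le>Suc n. of_nat (Suc n choose j) * (- 1) ^ j * apply_kernel (ballot2 j) f x))"
      by (intro ext arg_cong[where f = "(*) (2 ^ Suc n)"] binomial_alternating_sum_Suc[symmetric])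
    also have "\<dots> = apply_kernel (laplacian_coeff (Suc n)) f"
      unfolding eq
      by (simp only: sum_distrib_left mult.assoc)
    finally show ?case .
  qed
qed

section \<open>Identification of the semigroup and of its kernel\<close>

lemma L2_flow_diff:
  assumes "f \<in> L2_flow" "g \<in> L2_flow"
  shows "(\<lambda>x. f x - g x) \<in> L2_flow"
proof -
  have "(\<lambda>x. 2 * ((cmod (f x))\<^sup>2 * flow_measure x) + 2 * ((cmod (g x))\<^sup>2 * flow_measure x)) summable_on UNIV"
    using assms by (intro summable_on_add summable_on_cmult_right) (simp_all add: L2_flow_def)
  then have "(\<lambda>x. (cmod (f x - g x))\<^sup>2 * flow_measure x) summable_on UNIV"
  proof (rule summable_on_comparison_test)
    fix x
    have "(cmod (f x - g x))\<^sup>2 \<le> (cmod (f x) + cmod (g x))\<^sup>2"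
      by (intro power_mono norm_triangle_ineq4) simp
    also have "\<dots> \<le> 2 * (cmod (f x))\<^sup>2 + 2 * (cmod (g x))\<^sup>2"
      using zero_le_power2[of "cmod (f x) - cmod (g x)"] unfolding power2_diff power2_sum by simp
    finally have "(cmod (f x - g x))\<^sup>2 * flow_measure x \<le>
        (2 * (cmod (f x))\<^sup>2 + 2 * (cmod (g x))\<^sup>2) * flow_measure x"
      by (rule mult_right_mono) simp
    then show "(cmod (f x - g x))\<^sup>2 * flow_measure x \<le>
        2 * ((cmod (f x))\<^sup>2 * flow_measure x) + 2 * ((cmod (g x))\<^sup>2 * flow_measure x)"
      by (simp only: distrib_right mult.assoc)
  qed auto
  then show ?thesis by (simp add: L2_flow_def)
qed

lemma cmod_le_L2_flow_norm:
  assumes "f \<in> L2_flow"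
  shows "cmod (f x) \<le> L2_flow_norm f / sqrt (flow_measure x)"
proof -
  have "(\<Sum>x\<in>{x}. (cmod (f x))\<^sup>2 * flow_measure x) \<le> (\<Sum>\<^sub>\<infinity>x. (cmod (f x))\<^sup>2 * flow_measure x)"
    using assms by (intro finite_sum_le_infsum) (auto simp: L2_flow_def)
  then have "sqrt ((cmod (f x))\<^sup>2 * flow_measure x) \<le> L2_flow_norm f"
    unfolding L2_flow_norm_def by (intro real_sqrt_le_mono) simp
  then show ?thesis by (simp add: real_sqrt_mult le_divide_eq)
qed

text \<open>Point evaluations are bounded on \<open>L2_flow\<close>, so norm limits are pointwise
  limits. This gives the uniqueness required by the description in
  \<open>heat_semigroup\<close>.\<close>

lemma L2_flow_limit_unique:
  assumes "\<And>N. s N \<in> L2_flow" "g \<in> L2_flow" "h \<in> L2_flow"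
    and "(\<lambda>N. L2_flow_norm (\<lambda>x. s N x - g x)) \<longlonglongrightarrow> 0" "(\<lambda>N. L2_flow_norm (\<lambda>x. s N x - h x)) \<longlonglongrightarrow> 0"
  shows "g = h"
proof
  fix x
  have "(\<lambda>N. s N x) \<longlonglongrightarrow> g x" if g: "g \<in> L2_flow" "(\<lambda>N. L2_flow_norm (\<lambda>x. s N x - g x)) \<longlonglongrightarrow> 0" for g
  proof -
    have "(\<lambda>N. s N x - g x) \<longlonglongrightarrow> 0"
    proof (rule Lim_null_comparison)
      show "\<forall>\<^sub>F N in sequentially. cmod (s N x - g x) \<le>
          L2_flow_norm (\<lambda>x. s N x - g x) / sqrt (flow_measure x)"
        using cmod_le_L2_flow_norm[OF L2_flow_diff[OF assms(1) g(1)]] by simp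
      show "(\<lambda>N. L2_flow_norm (\<lambda>x. s N x - g x) / sqrt (flow_measure x)) \<longlonglongrightarrow> 0"
        using tendsto_divide[OF g(2) tendsto_const[of "sqrt (flow_measure x)"]] by simp
    qed
    then show ?thesis by (simp add: LIM_zero_iff)
  qed
  then show "g x = h x" using assms LIMSEQ_unique by blast
qed

lemma l1_bound_heat_coeff:
  assumes "t \<ge> 1"
  shows "l1_bound (heat_coeff t) (heat_const 0)"
  using heat_coeff_bounds(1)[OF assms, of 0] by (intro l1_boundI) (simp add: case_prod_unfold)

text \<open>The partial sums of the exponential are operators with l1 coefficients; by
  \<open>schur_test\<close> their l1 convergence implies norm convergence.\<close>

lemma heat_semigroup_eq:
  assumes t: "t \<ge> 1" and f: "f \<in> L2_flow"
  shows "heat_semigroup t f = apply_kernel (heat_coeff t) f"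
proof -
  have t0: "t \<ge> 0" using t by simp
  obtain \<tau> where \<tau>: "\<tau> \<longlonglongrightarrow> 0" "\<And>N. l1_bound (\<lambda>p. (\<Sum>n<N. (- t) ^ n / fact n * laplacian_coeff n p) - heat_coeff t p) (\<tau> N)"
    using heat_coeff_partial_sums[OF t0] by blast
  define v where "v = (\<lambda>N p. \<Sum>n<N. (- t) ^ n / fact n * laplacian_coeff n p)"
  have v\<tau>: "l1_bound (\<lambda>p. v N p - heat_coeff t p) (\<tau> N)" for N
    using \<tau>(2)[of N] unfolding v_def .
  define s where "s = (\<lambda>N x. \<Sum>n<N. of_real ((- t) ^ n / fact n) * (flow_laplacian ^^ n) f x)"
  define g where "g = apply_kernel (heat_coeff t) f"
  have v: "\<exists>M. l1_bound (v N) M" for N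
    unfolding v_def by (rule exI, rule l1_bound_sum, rule finite_lessThan, rule l1_bound_laplacian_coeff)
  have s: "s N = apply_kernel (v N) f" for N
  proof
    fix x
    show "s N x = apply_kernel (v N) f x"
      using apply_kernel_sum[of "{..<N}" laplacian_coeff, OF l1_bound_laplacian_coeff f, of "\<lambda>n. (- t) ^ n / fact n" x]
      unfolding s_def v_def flow_laplacian_funpow[OF f] by simp
  qed
  have sL2: "s N \<in> L2_flow" for N using v[of N] schur_test(1)[OF _ f] unfolding s by blast
  have gL2: "g \<in> L2_flow" unfolding g_def by (rule schur_test(1)[OF l1_bound_heat_coeff[OF t] f])
  have diff: "(\<lambda>x. s N x - g x) = apply_kernel (\<lambda>p. v N p - heat_coeff t p) f" for N
    using v[of N] apply_kernel_diff[OF _ l1_bound_heat_coeff[OF t] f] unfolding s g_def by fastforce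
  have lim: "(\<lambda>N. L2_flow_norm (\<lambda>x. s N x - g x)) \<longlonglongrightarrow> 0"
  proof (rule Lim_null_comparison)
    show "\<forall>\<^sub>F N in sequentially. norm (L2_flow_norm (\<lambda>x. s N x - g x)) \<le> \<tau> N * L2_flow_norm f"
    proof (intro always_eventually allI)
      fix N
      have "L2_flow_norm (\<lambda>x. s N x - g x) \<ge> 0"
        unfolding L2_flow_norm_def by (simp add: infsum_nonneg)
      then show "norm (L2_flow_norm (\<lambda>x. s N x - g x)) \<le> \<tau> N * L2_flow_norm f"
        using schur_test(2)[OF v\<tau> f, of N] unfolding diff[symmetric] by simp
    qed
    show "(\<lambda>N. \<tau> N * L2_flow_norm f) \<longlonglongrightarrow> 0" using tendsto_mult_left_zero[OF \<tau>(1)] .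
  qed
  have "heat_semigroup t f = g"
    unfolding heat_semigroup_def s_def[symmetric]
  proof (rule the_equality)
    show "g \<in> L2_flow \<and> (\<lambda>N. L2_flow_norm (\<lambda>x. (\<Sum>n<N. of_real ((- t) ^ n / fact n) *
        (flow_laplacian ^^ n) f x) - g x)) \<longlonglongrightarrow> 0"
      using gL2 lim unfolding s_def by simp
    show "h = g" if "h \<in> L2_flow \<and> (\<lambda>N. L2_flow_norm (\<lambda>x. (\<Sum>n<N. of_real ((- t) ^ n / fact n) *
        (flow_laplacian ^^ n) f x) - h x)) \<longlonglongrightarrow> 0" for h
      using that L2_flow_limit_unique[OF sL2 _ gL2 _ lim, of h] unfolding s_def by simp
  qed
  then show ?thesis by (simp add: g_def)
qed

text \<open>Uniqueness follows by testing on the indicator of one vertex, which reads off a single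
  entry of the kernel.\<close>

lemma heat_kernel_eq:
  assumes t: "t \<ge> 1"
  shows "heat_kernel t = (\<lambda>x y. of_real (kernel (heat_coeff t) x y))"
  unfolding heat_kernel_def
proof (rule the_equality)
  let ?H = "\<lambda>x y. complex_of_real (kernel (heat_coeff t) x y)"
  show *: "\<forall>f\<in>L2_flow. \<forall>x. ((\<lambda>y. ?H x y * f y * of_real (flow_measure y)) has_sum heat_semigroup t f x) UNIV"
    using apply_kernel_has_sum[OF l1_bound_heat_coeff[OF t]] heat_semigroup_eq[OF t] by simp
  fix H
  assume H: "\<forall>f\<in>L2_flow. \<forall>x. ((\<lambda>y. H x y * f y * of_real (flow_measure y)) has_sum heat_semigroup t f x) UNIV"
  show "H = ?H"
  proof (intro ext)
    fix x y
    define \<delta> :: "'a \<Rightarrow> complex" where "\<delta> = (\<lambda>z. if z = y then 1 else 0)"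
    have "\<delta> \<in> L2_flow"
      unfolding L2_flow_def mem_Collect_eq
      by (rule has_sum_imp_summable, rule has_sum_finite_neutralI[where B = "{y}"]) (auto simp: \<delta>_def)
    have val: "heat_semigroup t \<delta> x = K x y * of_real (flow_measure y)"
      if "\<forall>f\<in>L2_flow. \<forall>x. ((\<lambda>y. K x y * f y * of_real (flow_measure y)) has_sum heat_semigroup t f x) UNIV" for K
    proof (rule has_sum_unique)
      show "((\<lambda>y. K x y * \<delta> y * of_real (flow_measure y)) has_sum heat_semigroup t \<delta> x) UNIV"
        using that \<open>\<delta> \<in> L2_flow\<close> by blast
      show "((\<lambda>y. K x y * \<delta> y * of_real (flow_measure y)) has_sum (K x y * of_real (flow_measure y))) UNIV"
        by (rule has_sum_finite_neutralI[where B = "{y}"]) (auto simp: \<delta>_def)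
    qed
    show "H x y = ?H x y" using val[OF H] val[OF *] by simp
  qed
qed

section \<open>The weighted estimates for the heat kernel\<close>

lemma weighted_kernel_infsum_le:
  assumes \<epsilon>: "\<epsilon> \<ge> 0" and t: "t \<ge> 1"
    and M: "\<And>G. finite G \<Longrightarrow> (\<Sum>(a, b)\<in>G. \<bar>c (a, b)\<bar> * exp (\<epsilon> / sqrt t * (real a + real b))) \<le> M"
  shows "(SUP y. \<Sum>\<^sub>\<infinity>x. ennreal (\<bar>kernel c x y\<bar> * exp (\<epsilon> * real (gdist x y) / sqrt t) * flow_measure x)) \<le> ennreal M"
\<comment> \<open>Over the extended nonnegative reals every sum exists, so bounds on finite sums
  suffice.\<close>
proof (rule SUP_least, rule infsum_le_finite_sums)
  fix y and F :: "'a set" assume F: "finite F"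
  have "(\<Sum>x\<in>F. \<bar>kernel c x y\<bar> * exp (\<epsilon> / sqrt t * real (gdist x y)) * flow_measure x) \<le> M"
    using \<epsilon> t F M by (intro kernel_weighted_sum_le) auto
  then show "(\<Sum>x\<in>F. ennreal (\<bar>kernel c x y\<bar> * exp (\<epsilon> * real (gdist x y) / sqrt t) * flow_measure x)) \<le> ennreal M"
    by (simp add: sum_ennreal ennreal_leI)
qed (simp add: nonneg_summable_on_complete)

lemma heat_kernel_bounds:
  assumes \<epsilon>: "\<epsilon> \<ge> 0" and t: "t \<ge> 1"
  defines "S \<equiv> \<lambda>H :: 'a \<Rightarrow> 'a \<Rightarrow> complex. (SUP y. \<Sum>\<^sub>\<infinity>x. ennreal (cmod (H x y) *
    exp (\<epsilon> * real (gdist x y) / sqrt t) * flow_measure x))"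
  shows "S (heat_kernel t) \<le> ennreal (heat_const \<epsilon>)"
    and "S (grad_x (heat_kernel t)) \<le> ennreal (heat_const \<epsilon> / sqrt t)"
    and "S (grad_y (heat_kernel t)) \<le> ennreal (heat_const \<epsilon> / sqrt t)"
    and "S (grad_y (grad_x (heat_kernel t))) \<le> ennreal (heat_const \<epsilon> / t)"
proof -
  note c = l1_bound_summable[OF l1_bound_heat_coeff[OF t]]
  note b = heat_coeff_bounds[OF t \<epsilon>]
  note le = weighted_kernel_infsum_le[OF \<epsilon> t]
  have x: "grad_x (heat_kernel t) = (\<lambda>x y. of_real (kernel (diff_fst (heat_coeff t)) x y))"
    by (simp add: fun_eq_iff grad_x_def flow_grad_def heat_kernel_eq[OF t] kernel_diff_fst[OF c])
  have y: "grad_y (heat_kernel t) = (\<lambda>x y. of_real (kernel (diff_snd (heat_coeff t)) x y))"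
    by (simp add: fun_eq_iff grad_y_def flow_grad_def heat_kernel_eq[OF t] kernel_diff_snd[OF c])
  have xy: "grad_y (grad_x (heat_kernel t)) = (\<lambda>x y. of_real (kernel (diff_snd (diff_fst (heat_coeff t))) x y))"
    unfolding x by (simp add: fun_eq_iff grad_y_def flow_grad_def kernel_diff_snd[OF summable_diff_fst[OF c]])
  show "S (heat_kernel t) \<le> ennreal (heat_const \<epsilon>)"
    unfolding S_def heat_kernel_eq[OF t] norm_of_real by (rule le) (rule b(1))
  show "S (grad_x (heat_kernel t)) \<le> ennreal (heat_const \<epsilon> / sqrt t)"
    unfolding S_def x norm_of_real by (rule le) (rule b(2))
  show "S (grad_y (heat_kernel t)) \<le> ennreal (heat_const \<epsilon> / sqrt t)"
    unfolding S_def y norm_of_real by (rule le) (rule b(3))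
  show "S (grad_y (grad_x (heat_kernel t))) \<le> ennreal (heat_const \<epsilon> / t)"
    unfolding S_def xy norm_of_real by (rule le) (rule b(4))
qed

end

theorem theorem1p1:
  fixes \<epsilon> :: real
  assumes "\<epsilon> \<ge> 0"
  shows "\<exists>C::real. C > 0 \<and>
    (\<forall>(q::nat) (adj :: 'a \<Rightarrow> 'a \<Rightarrow> bool) (\<omega> :: nat \<Rightarrow> 'a) (t::real).
      flow_tree q adj \<omega> \<and> t \<ge> 1 \<longrightarrow>
        (SUP y. \<Sum>\<^sub>\<infinity>x. ennreal (cmod (flow_tree.heat_kernel q adj \<omega> t x y)
            * exp (\<epsilon> * real (homogeneous_tree.gdist adj x y) / sqrt t)
            * flow_tree.flow_measure q adj \<omega> x)) \<le> ennreal C \<and>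
        (SUP y. \<Sum>\<^sub>\<infinity>x. ennreal (cmod (flow_tree.grad_x adj \<omega> (flow_tree.heat_kernel q adj \<omega> t) x y)
            * exp (\<epsilon> * real (homogeneous_tree.gdist adj x y) / sqrt t)
            * flow_tree.flow_measure q adj \<omega> x)) \<le> ennreal (C / sqrt t) \<and>
        (SUP y. \<Sum>\<^sub>\<infinity>x. ennreal (cmod (flow_tree.grad_y adj \<omega> (flow_tree.heat_kernel q adj \<omega> t) x y)
            * exp (\<epsilon> * real (homogeneous_tree.gdist adj x y) / sqrt t)
            * flow_tree.flow_measure q adj \<omega> x)) \<le> ennreal (C / sqrt t) \<and>
        (SUP y. \<Sum>\<^sub>\<infinity>x. ennreal (cmod (flow_tree.grad_y adj \<omega>
              (flow_tree.grad_x adj \<omega> (flow_tree.heat_kernel q adj \<omega> t)) x y)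
            * exp (\<epsilon> * real (homogeneous_tree.gdist adj x y) / sqrt t)
            * flow_tree.flow_measure q adj \<omega> x)) \<le> ennreal (C / t))"
  \<comment> \<open>The witness involves neither the tree nor \<open>t\<close>, so it can be chosen
    before them.\<close>
  using flow_tree.heat_kernel_bounds[OF _ assms] heat_const_pos
  by (intro exI[of _ "heat_const \<epsilon>"] conjI allI impI) auto

end
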